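(* Fix a natural number $n\ge 2$. Let $\lambda_0>0$, $\Lambda>0$ and $\lambda_i=\lambda_0+i\Lambda$, $t_i(w)(z)=(1-zw)^{-\lambda_i}$ ($0\le i\le n-1$) be the weights, valency and atoms of a quasi-homogeneous holomorphic curve. For complex constants $m_{i,j}$, $0\le i<j\le n-1$, let $S_{i,j}$ be the densely defined linear transformation from $\mathbb A^{(\lambda_j)}(\mathbb D)$ to $\mathbb A^{(\lambda_i)}(\mathbb D)$ given by $S_{i,j}(t_j(w))=m_{i,j}\,t_i^{(j-i-1)}(w)$, $w\in\mathbb D$, and let $T$ be the upper triangular linear transformation, densely defined on $\mathbb A^{(\lambda_0)}(\mathbb D)\oplus\cdots\oplus\mathbb A^{(\lambda_{n-1})}(\mathbb D)$, with diagonal entries $T_0,\dots,T_{n-1}$ and $(i,j)$ entry $S_{i,j}$ for $i<j$. Suppose that $\Lambda<2$. (1) If $\Lambda\in\left[1+\frac{n-3}{n-1},\,2\right)$, $n\ge2$, then $T$ is bounded. (2) Let $n\ge 4$ and $0\le k\le n-3$. If $\Lambda\in\left[1+\frac{n-k-4}{n-k-2},\,1+\frac{n-k-3}{n-k-1}\right)$, then $T$ is bounded only if $m_{i,j}=0$ whenever $j-i\ge n-k-1$. (3) Let $n\ge 3$. If $\Lambda\in(0,1)$, then $T$ is bounded only if $m_{i,j}=0$ whenever $j>i+1$, $i=0,1,\dots,n-2$.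
   Context: $\mathbb D$ is the open unit disc. For $\lambda>0$, $\mathbb A^{(\lambda)}(\mathbb D)$ is the Hilbert space of holomorphic functions on $\mathbb D$ with reproducing kernel $(1-z\bar w)^{-\lambda}$. $T_i$ is the adjoint of the operator of multiplication by the coordinate function on $\mathbb A^{(\lambda_i)}(\mathbb D)$, so $T_it_i(w)=w\,t_i(w)$. $t_i^{(k)}$ denotes the $k$-th derivative of $t_i$ with respect to $w$. "Bounded" means extending to a bounded operator on $\mathbb A^{(\lambda_0)}(\mathbb D)\oplus\cdots\oplus\mathbb A^{(\lambda_{n-1})}(\mathbb D)$. *)

theory Defs
  imports "HOL-Complex_Analysis.Complex_Analysis" "HOL-Library.Function_Algebras"
begin

section \<open>Complex vector spaces of functions\<close>

definition fscale :: "complex \<Rightarrow> ('x \<Rightarrow> complex) \<Rightarrow> 'x \<Rightarrow> complex" where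
  "fscale c f = (\<lambda>x. c * f x)"

global_interpretation fun_space: vector_space "fscale :: complex \<Rightarrow> ('x \<Rightarrow> complex) \<Rightarrow> 'x \<Rightarrow> complex"
  by unfold_locales (auto simp: fscale_def fun_eq_iff algebra_simps)

definition linear_on_with ::
  "(complex \<Rightarrow> 'a::ab_group_add \<Rightarrow> 'a) \<Rightarrow> (complex \<Rightarrow> 'b::ab_group_add \<Rightarrow> 'b) \<Rightarrow> 'a set \<Rightarrow> ('a \<Rightarrow> 'b) \<Rightarrow> bool"
  where
  "linear_on_with s1 s2 V A \<longleftrightarrow>
     (\<forall>x\<in>V. \<forall>y\<in>V. A (x + y) = A x + A y) \<and> (\<forall>c. \<forall>x\<in>V. A (s1 c x) = s2 c (A x))"

section \<open>Reproducing kernel Hilbert spaces\<close>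

type_synonym 'x inner_product = "('x \<Rightarrow> complex) \<Rightarrow> ('x \<Rightarrow> complex) \<Rightarrow> complex"

definition ip_norm :: "'x inner_product \<Rightarrow> ('x \<Rightarrow> complex) \<Rightarrow> real" where
  "ip_norm ip f = sqrt (Re (ip f f))"

text \<open>Inner products are linear in the first argument and conjugate-linear in the second.
  Nothing is required of \<open>ip\<close> outside \<open>H\<close>.\<close>

definition inner_product_on :: "('x \<Rightarrow> complex) set \<Rightarrow> 'x inner_product \<Rightarrow> bool" where
  "inner_product_on H ip \<longleftrightarrow>
     (\<forall>f\<in>H. \<forall>g\<in>H. \<forall>h\<in>H. ip (f + g) h = ip f h + ip g h) \<and>
     (\<forall>c. \<forall>f\<in>H. \<forall>g\<in>H. ip (fscale c f) g = c * ip f g) \<and>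
     (\<forall>f\<in>H. \<forall>g\<in>H. ip g f = cnj (ip f g)) \<and>
     (\<forall>f\<in>H. 0 \<le> Re (ip f f)) \<and>
     (\<forall>f\<in>H. ip f f = 0 \<longrightarrow> f = 0)"

definition hilbert_function_space :: "('x \<Rightarrow> complex) set \<Rightarrow> 'x inner_product \<Rightarrow> bool" where
  "hilbert_function_space H ip \<longleftrightarrow>
     fun_space.subspace H \<and> inner_product_on H ip \<and>
     (\<forall>F :: nat \<Rightarrow> 'x \<Rightarrow> complex. (\<forall>n. F n \<in> H) \<longrightarrow>
        (\<forall>e>0. \<exists>N. \<forall>p\<ge>N. \<forall>q\<ge>N. ip_norm ip (F p - F q) < e) \<longrightarrow>
        (\<exists>f\<in>H. (\<lambda>n. ip_norm ip (F n - f)) \<longlonglongrightarrow> 0))"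

text \<open>Functions on a set \<open>X\<close> are represented by total functions that vanish off \<open>X\<close>, so that
  equality of elements of \<open>H\<close> is equality on \<open>X\<close>.\<close>

definition has_reproducing_kernel ::
  "'x set \<Rightarrow> ('x \<Rightarrow> 'x \<Rightarrow> complex) \<Rightarrow> ('x \<Rightarrow> complex) set \<Rightarrow> 'x inner_product \<Rightarrow> bool" where
  "has_reproducing_kernel X K H ip \<longleftrightarrow>
     hilbert_function_space H ip \<and>
     (\<forall>f\<in>H. \<forall>x. x \<notin> X \<longrightarrow> f x = 0) \<and>
     (\<forall>w\<in>X. (\<lambda>z. if z \<in> X then K z w else 0) \<in> H \<and>
       (\<forall>f\<in>H. ip f (\<lambda>z. if z \<in> X then K z w else 0) = f w))"

abbreviation unit_disc :: "complex set" where
  "unit_disc \<equiv> ball 0 1"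

text \<open>\<open>is_A_space l H ip\<close>: the set \<open>H\<close> with inner product \<open>ip\<close> is the space
  $\mathbb A^{(l)}(\mathbb D)$. A reproducing kernel determines both the functions and
  the inner product on them, so \<open>H\<close>, and \<open>ip\<close> on \<open>H\<close>, are unique. For \<open>z\<close>, \<open>w\<close> in the disc
  the base of the power has positive real part, so \<open>powr\<close> is the holomorphic branch equal to \<open>1\<close>
  at \<open>z = 0\<close>.\<close>

definition is_A_space :: "real \<Rightarrow> (complex \<Rightarrow> complex) set \<Rightarrow> complex inner_product \<Rightarrow> bool" where
  "is_A_space l H ip \<longleftrightarrow>
     (\<forall>f\<in>H. f holomorphic_on unit_disc) \<and>
     has_reproducing_kernel unit_disc (\<lambda>z w. (1 - z * cnj w) powr (- of_real l)) H ip"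

definition adjoint_op ::
  "('x \<Rightarrow> complex) set \<Rightarrow> 'x inner_product \<Rightarrow> (('x \<Rightarrow> complex) \<Rightarrow> 'x \<Rightarrow> complex)
     \<Rightarrow> ('x \<Rightarrow> complex) \<Rightarrow> 'x \<Rightarrow> complex" where
  "adjoint_op H ip A f = (THE h. h \<in> H \<and> (\<forall>g\<in>H. ip (A g) f = ip g h))"

definition mult_coord :: "(complex \<Rightarrow> complex) \<Rightarrow> complex \<Rightarrow> complex" where
  "mult_coord f = (\<lambda>z. z * f z)"

section \<open>Atoms\<close>

definition atom :: "real \<Rightarrow> complex \<Rightarrow> complex \<Rightarrow> complex" where
  "atom l w = (\<lambda>z. if z \<in> unit_disc then (1 - z * w) powr (- of_real l) else 0)"

text \<open>The derivative in \<open>w\<close> of the curve \<open>w \<mapsto> atom l w\<close>, taken pointwise in \<open>z\<close>; point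
  evaluations being continuous, these are the values of the derivative in the norm.\<close>

definition atom_deriv :: "nat \<Rightarrow> real \<Rightarrow> complex \<Rightarrow> complex \<Rightarrow> complex" where
  "atom_deriv k l w = (\<lambda>z. (deriv ^^ k) (\<lambda>u. atom l u z) w)"

definition atom_span :: "real \<Rightarrow> (complex \<Rightarrow> complex) set" where
  "atom_span l = fun_space.span (atom l ` unit_disc)"

section \<open>Finite direct sums and upper triangular operators\<close>

text \<open>An element of the direct sum of $n$ spaces is a sequence \<open>F\<close> with components
  \<open>F 0, \<dots>, F (n - 1)\<close>, continued by \<open>0\<close>.\<close>

definition direct_sum :: "nat \<Rightarrow> (nat \<Rightarrow> ('x \<Rightarrow> complex) set) \<Rightarrow> (nat \<Rightarrow> 'x \<Rightarrow> complex) set" where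
  "direct_sum n V = {F. (\<forall>i<n. F i \<in> V i) \<and> (\<forall>i\<ge>n. F i = 0)}"

definition direct_sum_norm ::
  "nat \<Rightarrow> (nat \<Rightarrow> 'x inner_product) \<Rightarrow> (nat \<Rightarrow> 'x \<Rightarrow> complex) \<Rightarrow> real" where
  "direct_sum_norm n ip F = sqrt (\<Sum>i<n. (ip_norm (ip i) (F i))\<^sup>2)"

definition sum_scale :: "complex \<Rightarrow> (nat \<Rightarrow> 'x \<Rightarrow> complex) \<Rightarrow> nat \<Rightarrow> 'x \<Rightarrow> complex" where
  "sum_scale c F = (\<lambda>i. fscale c (F i))"

text \<open>Boundedness of an operator \<open>A\<close> with domain \<open>D\<close>: it extends to a bounded linear operator
  on the whole direct sum.\<close>

definition bounded_on_direct_sum ::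
  "nat \<Rightarrow> (nat \<Rightarrow> ('x \<Rightarrow> complex) set) \<Rightarrow> (nat \<Rightarrow> 'x inner_product) \<Rightarrow> (nat \<Rightarrow> 'x \<Rightarrow> complex) set
     \<Rightarrow> ((nat \<Rightarrow> 'x \<Rightarrow> complex) \<Rightarrow> nat \<Rightarrow> 'x \<Rightarrow> complex) \<Rightarrow> bool" where
  "bounded_on_direct_sum n H ip D A \<longleftrightarrow>
     (\<exists>B C. B ` direct_sum n H \<subseteq> direct_sum n H \<and>
        linear_on_with sum_scale sum_scale (direct_sum n H) B \<and>
        (\<forall>F \<in> direct_sum n H. direct_sum_norm n ip (B F) \<le> C * direct_sum_norm n ip F) \<and>
        (\<forall>F \<in> D. B F = A F))"

definition upper_triangular_op ::
  "nat \<Rightarrow> (nat \<Rightarrow> ('x \<Rightarrow> complex) \<Rightarrow> 'x \<Rightarrow> complex) \<Rightarrow> (nat \<Rightarrow> nat \<Rightarrow> ('x \<Rightarrow> complex) \<Rightarrow> 'x \<Rightarrow> complex)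
     \<Rightarrow> (nat \<Rightarrow> 'x \<Rightarrow> complex) \<Rightarrow> nat \<Rightarrow> 'x \<Rightarrow> complex" where
  "upper_triangular_op n T S F =
     (\<lambda>i. if i < n then T i (F i) + (\<Sum>j\<in>{i<..<n}. S i j (F j)) else 0)"

end

theory Submission
  imports Defs
begin

text \<open>
  In power series coordinates the space $\mathbb A^{(l)}$ is a weighted sequence space: if
  \<open>a\<^sub>k = pochhammer l k / fact k\<close> are the coefficients of the kernel, then
  \<open>f(z) = \<Sum>k. x\<^sub>k z\<^sup>k\<close> belongs to the space iff \<open>\<Sum>k. \<bar>x\<^sub>k\<bar>\<^sup>2 / a\<^sub>k\<close> is finite, and this sum is the square
  of its norm. As the space is given only through its reproducing kernel, this description has to be
  extracted from the kernel: the Taylor coefficients are limits of combinations of point evaluations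
  (\<open>taylor_coeff_represented\<close>), so the monomials lie in the space and are orthogonal, and
  completeness gives the rest (\<open>Riesz_Fischer\<close>, \<open>ip_sums\<close>).

  In these coordinates \<open>T i\<close> is a weighted backward shift, always bounded (\<open>adjoint_mult_coord\<close>), and
  \<open>S i j\<close> is \<open>m i j\<close> times a weighted forward shift by \<open>r = j - i - 1\<close> places whose weights grow like \<open>k\<close> to the power
  \<open>(lam i + 2 * r - lam j) / 2\<close>. If \<open>lam j \<ge> lam i + 2 * r\<close>, the weights are bounded
  (\<open>kernel_coeff_derivative_bound\<close>) and \<open>S i j\<close> extends to a bounded operator
  (\<open>bounded_between_deriv_op\<close>); a matrix of bounded operators is bounded (\<open>bounded_matrix_op\<close>).

  Conversely, if \<open>lam j < lam i + 2 * r\<close> and \<open>T\<close> is bounded, then \<open>m i j = 0\<close>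
  (\<open>zero_if_norm_bound\<close>). The atoms themselves are test vectors for this: the norm of \<open>atom (lam j) s\<close> is
  \<open>(1 - s\<^sup>2) powr (- lam j / 2)\<close>, and the value at \<open>s\<close> of the \<open>r\<close>-th derivative of \<open>atom (lam i) s\<close> is a
  constant times \<open>s\<^sup>r (1 - s\<^sup>2) powr (- lam i - r)\<close>, too large as \<open>s\<close> tends to \<open>1\<close>.

  Since \<open>lam j - lam i = (j - i) * Lam\<close>, the dividing line for the entry \<open>(i, j)\<close> is
  \<open>Lam \<ge> 2 - 2 / (j - i)\<close>, and the three parts are this criterion read off for the possible
  differences \<open>j - i\<close>.
\<close>

section \<open>Inner products on spaces of functions\<close>

locale function_inner_product =
  fixes H :: "('x \<Rightarrow> complex) set" and ip :: "'x inner_product"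
  assumes subspace: "fun_space.subspace H" and inner_product: "inner_product_on H ip"
begin

lemmas mem_add = fun_space.subspace_add[OF subspace]
lemmas mem_diff = fun_space.subspace_diff[OF subspace]
lemmas mem_scale = fun_space.subspace_scale[OF subspace]
lemmas mem_0 = fun_space.subspace_0[OF subspace]
lemmas mem_sum = fun_space.subspace_sum[OF subspace]

lemmas inner_product_conjuncts = inner_product[unfolded inner_product_on_def]

lemma ip_add_left: "f \<in> H \<Longrightarrow> g \<in> H \<Longrightarrow> h \<in> H \<Longrightarrow> ip (f + g) h = ip f h + ip g h"
  by (rule inner_product_conjuncts[THEN conjunct1, rule_format])

lemma ip_scale_left: "f \<in> H \<Longrightarrow> g \<in> H \<Longrightarrow> ip (fscale c f) g = c * ip f g"
  by (rule inner_product_conjuncts[THEN conjunct2, THEN conjunct1, rule_format])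

lemma ip_commute: "f \<in> H \<Longrightarrow> g \<in> H \<Longrightarrow> ip g f = cnj (ip f g)"
  by (rule inner_product_conjuncts[THEN conjunct2, THEN conjunct2, THEN conjunct1, rule_format])

lemma ip_self_nonneg: "f \<in> H \<Longrightarrow> 0 \<le> Re (ip f f)"
  by (rule inner_product_conjuncts[THEN conjunct2, THEN conjunct2, THEN conjunct2, THEN conjunct1,
        rule_format])

lemma ip_self_eq_0D: "f \<in> H \<Longrightarrow> ip f f = 0 \<Longrightarrow> f = 0"
  by (rule inner_product_conjuncts[THEN conjunct2, THEN conjunct2, THEN conjunct2, THEN conjunct2,
        rule_format])

lemma ip_0_left: "f \<in> H \<Longrightarrow> ip 0 f = 0"
  using ip_add_left[of 0 0 f] mem_0 by simp

lemma ip_diff_left: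
  assumes "f \<in> H" "g \<in> H" "h \<in> H"
  shows "ip (f - g) h = ip f h - ip g h"
  using ip_add_left[of "f - g" g h] mem_diff assms by simp

lemma ip_add_right: "f \<in> H \<Longrightarrow> g \<in> H \<Longrightarrow> h \<in> H \<Longrightarrow> ip h (f + g) = ip h f + ip h g"
  by (metis complex_cnj_add ip_add_left ip_commute mem_add)

lemma ip_diff_right: "f \<in> H \<Longrightarrow> g \<in> H \<Longrightarrow> h \<in> H \<Longrightarrow> ip h (f - g) = ip h f - ip h g"
  by (metis complex_cnj_diff ip_diff_left ip_commute mem_diff)

lemma ip_scale_right: "f \<in> H \<Longrightarrow> g \<in> H \<Longrightarrow> ip g (fscale c f) = cnj c * ip g f"
  by (metis complex_cnj_mult ip_scale_left ip_commute mem_scale)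

lemma ip_sum_left:
  assumes "\<And>k. k \<in> A \<Longrightarrow> h k \<in> H" "f \<in> H"
  shows "ip (\<Sum>k\<in>A. h k) f = (\<Sum>k\<in>A. ip (h k) f)"
  using assms
  by (induction A rule: infinite_finite_induct) (auto simp: ip_0_left ip_add_left mem_sum)

lemma ip_sum_right:
  assumes "\<And>k. k \<in> A \<Longrightarrow> h k \<in> H" "f \<in> H"
  shows "ip f (\<Sum>k\<in>A. h k) = (\<Sum>k\<in>A. ip f (h k))"
proof -
  have "ip f (\<Sum>k\<in>A. h k) = cnj (ip (\<Sum>k\<in>A. h k) f)"
    using assms by (intro ip_commute mem_sum) auto
  also have "\<dots> = (\<Sum>k\<in>A. cnj (ip (h k) f))"
    using assms by (simp add: ip_sum_left)
  also have "\<dots> = (\<Sum>k\<in>A. ip f (h k))"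
    using assms by (intro sum.cong refl) (metis ip_commute)
  finally show ?thesis .
qed

lemma ip_norm_nonneg: "f \<in> H \<Longrightarrow> 0 \<le> ip_norm ip f"
  by (simp add: ip_norm_def ip_self_nonneg)

lemma ip_norm_square: "f \<in> H \<Longrightarrow> (ip_norm ip f)\<^sup>2 = Re (ip f f)"
  by (simp add: ip_norm_def ip_self_nonneg)

lemma ip_self: "f \<in> H \<Longrightarrow> ip f f = of_real ((ip_norm ip f)\<^sup>2)"
  using ip_commute[of f f] by (auto simp: ip_norm_square complex_eq_iff)

lemma ip_norm_eq_0D: "f \<in> H \<Longrightarrow> ip_norm ip f = 0 \<Longrightarrow> f = 0"
  by (simp add: ip_self ip_self_eq_0D)

lemma ip_norm_0: "ip_norm ip 0 = 0"
  by (simp add: ip_norm_def ip_0_left mem_0)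

lemma Cauchy_Schwarz:
  assumes f: "f \<in> H" and g: "g \<in> H"
  shows "cmod (ip f g) \<le> ip_norm ip f * ip_norm ip g"
proof (cases "g = 0")
  case True
  thus ?thesis using f ip_0_left[of f] ip_commute[of 0 f] by (simp add: mem_0 ip_norm_0)
next
  case False
  let ?N = "ip_norm ip g"
  have N: "?N > 0" using False ip_norm_eq_0D[OF g] ip_norm_nonneg[OF g] by fastforce
  define c where "c = ip f g / of_real (?N\<^sup>2)"
  have "ip (f - fscale c g) (f - fscale c g)
      = ip f f - cnj c * ip f g - c * cnj (ip f g) + c * cnj c * of_real (?N\<^sup>2)"
    using f g by (simp add: ip_diff_left ip_diff_right ip_scale_left ip_scale_right mem_scale
        mem_diff ip_commute[OF f g] ip_self[OF g] algebra_simps)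
  also have "\<dots> = of_real ((ip_norm ip f)\<^sup>2) - of_real ((cmod (ip f g))\<^sup>2 / ?N\<^sup>2)"
    using N complex_norm_square[of "ip f g"]
    by (simp add: c_def ip_self[OF f] field_simps power2_eq_square)
  finally have "0 \<le> (ip_norm ip f)\<^sup>2 - (cmod (ip f g))\<^sup>2 / ?N\<^sup>2"
    using ip_self_nonneg[of "f - fscale c g"] f g
    by (simp add: mem_scale mem_diff del: of_real_power of_real_divide)
  hence "(cmod (ip f g))\<^sup>2 \<le> (ip_norm ip f * ?N)\<^sup>2"
    using N by (simp add: field_simps)
  thus ?thesis using f g by (simp add: ip_norm_nonneg power2_le_iff_abs_le)
qed

lemma ip_norm_triangle:
  assumes f: "f \<in> H" and g: "g \<in> H"
  shows "ip_norm ip (f + g) \<le> ip_norm ip f + ip_norm ip g"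
proof -
  have "(ip_norm ip (f + g))\<^sup>2 = Re (ip f f) + Re (ip g g) + 2 * Re (ip f g)"
    using f g ip_commute[OF f g]
    by (simp add: ip_norm_square mem_add ip_add_left ip_add_right)
  also have "\<dots> \<le> (ip_norm ip f)\<^sup>2 + (ip_norm ip g)\<^sup>2 + 2 * (ip_norm ip f * ip_norm ip g)"
    using Cauchy_Schwarz[OF f g] complex_Re_le_cmod[of "ip f g"]
    by (simp add: ip_norm_square f g)
  also have "\<dots> = (ip_norm ip f + ip_norm ip g)\<^sup>2"
    by (simp add: power2_sum)
  finally show ?thesis
    by (rule power2_le_imp_le) (simp add: f g ip_norm_nonneg)
qed

lemma ip_norm_sum_le:
  assumes "\<And>k. k \<in> A \<Longrightarrow> h k \<in> H"
  shows "ip_norm ip (\<Sum>k\<in>A. h k) \<le> (\<Sum>k\<in>A. ip_norm ip (h k))"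
  using assms
proof (induction A rule: infinite_finite_induct)
  case (insert x A)
  have "ip_norm ip (h x + sum h A) \<le> ip_norm ip (h x) + ip_norm ip (sum h A)"
    by (intro ip_norm_triangle mem_sum) (use insert in auto)
  also have "\<dots> \<le> ip_norm ip (h x) + (\<Sum>k\<in>A. ip_norm ip (h k))"
    using insert by (intro add_left_mono) auto
  finally show ?case unfolding sum.insert[OF insert(1,2)] .
qed (auto simp: ip_norm_0)

lemma tendsto_ip_left:
  assumes "\<And>n. g n \<in> H" "h \<in> H" "f \<in> H" "(\<lambda>n. ip_norm ip (g n - h)) \<longlonglongrightarrow> 0"
  shows "(\<lambda>n. ip (g n) f) \<longlonglongrightarrow> ip h f"
proof (rule Lim_transform2[OF tendsto_const])
  have "(\<lambda>n. ip_norm ip (g n - h) * ip_norm ip f) \<longlonglongrightarrow> 0"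
    using tendsto_mult_right[OF assms(4), of "ip_norm ip f"] by simp
  hence "(\<lambda>n. ip (g n - h) f) \<longlonglongrightarrow> 0"
    by (rule Lim_null_comparison[rotated]) (use assms in \<open>simp add: Cauchy_Schwarz mem_diff\<close>)
  from tendsto_minus[OF this] show "(\<lambda>n. ip h f - ip (g n) f) \<longlonglongrightarrow> 0"
    using assms by (simp add: ip_diff_left)
qed

end

locale function_Hilbert_space = function_inner_product +
  assumes Hilbert: "hilbert_function_space H ip"
begin

text \<open>By the expansion
  \<open>\<parallel>g p - g q\<parallel>\<^sup>2 = \<langle>g p, g p\<rangle> + \<langle>g q, g q\<rangle> - \<langle>g p, g q\<rangle> - \<langle>g q, g p\<rangle>\<close>, a sequence is Cauchy as soon as
  its double sequence of inner products has a limit. This suits vectors whose inner products are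
  explicit power series.\<close>

lemma convergent_if_Gram_converges:
  assumes g: "\<And>n. g n \<in> H"
    and Gram: "\<And>e. e > 0 \<Longrightarrow> \<exists>N. \<forall>p\<ge>N. \<forall>q\<ge>N. cmod (ip (g p) (g q) - c) < e"
  obtains h where "h \<in> H" "(\<lambda>n. ip_norm ip (g n - h)) \<longlonglongrightarrow> 0"
proof -
  have "\<exists>N. \<forall>p\<ge>N. \<forall>q\<ge>N. ip_norm ip (g p - g q) < e" if e: "e > 0" for e
  proof -
    obtain N where N: "\<And>p q. p \<ge> N \<Longrightarrow> q \<ge> N \<Longrightarrow> cmod (ip (g p) (g q) - c) < e\<^sup>2 / 4"
      using Gram[of "e\<^sup>2 / 4"] e by auto
    have "ip_norm ip (g p - g q) < e" if "p \<ge> N" "q \<ge> N" for p q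
    proof -
      have "(ip_norm ip (g p - g q))\<^sup>2 = Re ((ip (g p) (g p) - c) + (ip (g q) (g q) - c)
             - (ip (g p) (g q) - c) - (ip (g q) (g p) - c))"
        using g by (simp add: ip_norm_square mem_diff ip_diff_left ip_diff_right)
      also have "\<dots> \<le> cmod (ip (g p) (g p) - c) + cmod (ip (g q) (g q) - c)
             + cmod (ip (g p) (g q) - c) + cmod (ip (g q) (g p) - c)"
        using complex_Re_le_cmod[of "ip (g p) (g p) - c"] complex_Re_le_cmod[of "ip (g q) (g q) - c"]
          abs_Re_le_cmod[of "ip (g p) (g q) - c"] abs_Re_le_cmod[of "ip (g q) (g p) - c"]
        by simp
      also have "\<dots> < e\<^sup>2"
        using N[of p p] N[of p q] N[of q p] N[of q q] that by simp
      finally show ?thesis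
        by (rule power2_less_imp_less) (use e in simp)
    qed
    thus ?thesis by blast
  qed
  hence "\<exists>h\<in>H. (\<lambda>n. ip_norm ip (g n - h)) \<longlonglongrightarrow> 0"
    using Hilbert[unfolded hilbert_function_space_def, THEN conjunct2, THEN conjunct2,
        THEN spec[of _ g]] g by simp
  thus ?thesis using that by blast
qed

end

section \<open>Taylor coefficients on the disc\<close>

definition taylor_coeff :: "(complex \<Rightarrow> complex) \<Rightarrow> nat \<Rightarrow> complex" where
  "taylor_coeff f k = (deriv ^^ k) f 0 / fact k"

lemma taylor_coeff_sums:
  assumes "f holomorphic_on unit_disc" "z \<in> unit_disc"
  shows "(\<lambda>k. taylor_coeff f k * z ^ k) sums f z"
  using holomorphic_power_series[OF assms] by (simp add: taylor_coeff_def)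

lemma taylor_coeff_eqI:
  assumes "\<And>z. z \<in> unit_disc \<Longrightarrow> (\<lambda>k. c k * z ^ k) sums f z"
  shows "taylor_coeff f k = c k"
proof -
  have "f has_fps_expansion Abs_fps c"
  proof (rule has_fps_expansionI)
    have "eventually (\<lambda>z. z \<in> unit_disc) (nhds (0::complex))"
      by (intro eventually_nhds_in_open) auto
    thus "eventually (\<lambda>u. (\<lambda>n. fps_nth (Abs_fps c) n * u ^ n) sums f u) (nhds 0)"
      by eventually_elim (use assms in simp)
  qed
  from fps_nth_fps_expansion[OF this, of k] show ?thesis by (simp add: taylor_coeff_def)
qed

lemma taylor_coeff_add:
  assumes "f holomorphic_on unit_disc" "g holomorphic_on unit_disc"
  shows "taylor_coeff (f + g) k = taylor_coeff f k + taylor_coeff g k"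
  by (rule taylor_coeff_eqI)
     (use sums_add[OF taylor_coeff_sums[OF assms(1)] taylor_coeff_sums[OF assms(2)]]
      in \<open>simp add: algebra_simps\<close>)

lemma taylor_coeff_fscale:
  assumes "f holomorphic_on unit_disc"
  shows "taylor_coeff (fscale c f) k = c * taylor_coeff f k"
  by (rule taylor_coeff_eqI)
     (use sums_mult[OF taylor_coeff_sums[OF assms(1)], of _ c] in \<open>simp add: fscale_def mult_ac\<close>)

text \<open>These are the numbers \<open>(-1)\<^sup>k * (-l gchoose k)\<close>, the Taylor coefficients of
  \<open>(1 - x) powr (- l)\<close>. For \<open>l > 0\<close> they are positive, which makes the kernel positive definite.\<close>

definition kernel_coeff :: "real \<Rightarrow> nat \<Rightarrow> real" where
  "kernel_coeff l k = pochhammer l k / fact k"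

lemma kernel_coeff_pos: "l > 0 \<Longrightarrow> kernel_coeff l k > 0"
  by (simp add: kernel_coeff_def pochhammer_pos)

lemma binomial_series:
  assumes "cmod x < 1"
  shows "(\<lambda>k. of_real (kernel_coeff l k) * x ^ k) sums (1 - x) powr (- of_real l)"
proof -
  have "(\<lambda>k. ((- of_real l) gchoose k) * (- x) ^ k) sums (1 + (- x)) powr (- of_real l)"
    using assms by (intro gen_binomial_complex) auto
  moreover have "((- of_real l) gchoose k) * (- x) ^ k = of_real (kernel_coeff l k) * x ^ k" for k
  proof -
    have "((- of_real l) gchoose k) * (- x) ^ k
        = ((- 1) ^ k * (- 1) ^ k) * (pochhammer (of_real l) k / fact k * x ^ k)"
      unfolding gbinomial_pochhammer power_minus[of x k] by simp
    thus ?thesis by (simp add: kernel_coeff_def pochhammer_of_real)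
  qed
  ultimately show ?thesis by simp
qed

lemma norm_mult_unit_disc: "z \<in> unit_disc \<Longrightarrow> w \<in> unit_disc \<Longrightarrow> cmod (z * w) < 1"
  using mult_strict_mono'[of "cmod z" 1 "cmod w" 1] by (simp add: norm_mult)

lemma atom_sums:
  assumes "z \<in> unit_disc" "w \<in> unit_disc"
  shows "(\<lambda>k. of_real (kernel_coeff l k) * w ^ k * z ^ k) sums atom l w z"
  using binomial_series[OF norm_mult_unit_disc[OF assms], of l] assms
  by (simp add: atom_def power_mult_distrib mult_ac)

lemma taylor_coeff_atom:
  assumes "w \<in> unit_disc"
  shows "taylor_coeff (atom l w) k = of_real (kernel_coeff l k) * w ^ k"
  by (rule taylor_coeff_eqI) (rule atom_sums[OF _ assms])

section \<open>The weighted spaces as spaces of power series\<close>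

locale A_space =
  fixes l :: real and H :: "(complex \<Rightarrow> complex) set" and ip :: "complex inner_product"
  assumes l_pos: "l > 0" and A_space: "is_A_space l H ip"

sublocale A_space \<subseteq> function_Hilbert_space H ip
  by unfold_locales
     (use A_space in \<open>simp_all add: is_A_space_def has_reproducing_kernel_def
        hilbert_function_space_def\<close>)

text \<open>The factor makes the inner product with this monomial equal to the \<open>k\<close>-th Taylor
  coefficient, without a further weight.\<close>

definition weighted_monomial :: "real \<Rightarrow> nat \<Rightarrow> complex \<Rightarrow> complex" where
  "weighted_monomial l k = (\<lambda>z. if z \<in> unit_disc then of_real (kernel_coeff l k) * z ^ k else 0)"

lemma taylor_coeff_weighted_monomial:
  "taylor_coeff (weighted_monomial l k) j = (if j = k then of_real (kernel_coeff l k) else 0)"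
proof (rule taylor_coeff_eqI)
  fix z :: complex assume "z \<in> unit_disc"
  moreover have "(\<lambda>j. if j = k then of_real (kernel_coeff l j) * z ^ j else 0)
      sums (of_real (kernel_coeff l k) * z ^ k)"
    by (rule sums_single)
  moreover have "(\<lambda>j. (if j = k then of_real (kernel_coeff l k) else 0) * z ^ j) =
      (\<lambda>j. if j = k then of_real (kernel_coeff l j) * z ^ j else 0)"
    by auto
  ultimately show "(\<lambda>j. (if j = k then of_real (kernel_coeff l k) else 0) * z ^ j)
      sums weighted_monomial l k z"
    by (simp add: weighted_monomial_def)
qed

context A_space
begin

lemma holomorphic: "f \<in> H \<Longrightarrow> f holomorphic_on unit_disc"
  using A_space unfolding is_A_space_def by simp

lemma vanishes_off_disc: "f \<in> H \<Longrightarrow> z \<notin> unit_disc \<Longrightarrow> f z = 0"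
  using A_space unfolding is_A_space_def has_reproducing_kernel_def by blast

lemma atom_mem:
  assumes "w \<in> unit_disc"
  shows "atom l w \<in> H"
proof -
  have "cnj w \<in> unit_disc" using assms by simp
  hence "(\<lambda>z. if z \<in> unit_disc then (1 - z * cnj (cnj w)) powr (- of_real l) else 0) \<in> H"
    using A_space unfolding is_A_space_def has_reproducing_kernel_def by blast
  thus ?thesis unfolding complex_cnj_cnj atom_def .
qed

lemma ip_atom:
  assumes "f \<in> H" "w \<in> unit_disc"
  shows "ip f (atom l w) = f (cnj w)"
proof -
  have "cnj w \<in> unit_disc" using assms by simp
  hence "ip f (\<lambda>z. if z \<in> unit_disc then (1 - z * cnj (cnj w)) powr (- of_real l) else 0) = f (cnj w)"
    using A_space assms(1) unfolding is_A_space_def has_reproducing_kernel_def by blast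
  thus ?thesis unfolding complex_cnj_cnj atom_def .
qed

lemma eq_if_taylor_coeff_eq:
  assumes "f \<in> H" "g \<in> H" "\<And>k. taylor_coeff f k = taylor_coeff g k"
  shows "f = g"
proof
  fix z
  show "f z = g z"
  proof (cases "z \<in> unit_disc")
    case True
    thus ?thesis
      using taylor_coeff_sums[OF holomorphic[OF assms(1)] True]
        taylor_coeff_sums[OF holomorphic[OF assms(2)] True] assms(3) by (simp add: sums_unique2)
  qed (simp add: vanishes_off_disc[OF assms(1)] vanishes_off_disc[OF assms(2)])
qed

text \<open>Only point evaluations are given as inner products, so the Taylor coefficients have to be
  obtained from them by a limit inside the space. Suppose \<open>h 0, \<dots>, h (k - 1)\<close> represent the
  coefficients below \<open>k\<close>. Then the inner product with
  \<open>(atom l u - (\<Sum>j<k. u\<^sup>j * h j)) / u\<^sup>k\<close> is, for small real \<open>u > 0\<close>, the remainder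
  \<open>(f u - (\<Sum>j<k. a\<^sub>j * u\<^sup>j)) / u\<^sup>k\<close> of the Taylor series of \<open>f\<close>, which tends to the coefficient \<open>a\<^sub>k\<close>. That
  these vectors converge in norm as \<open>u\<close> tends to \<open>0\<close> follows from their inner products: these
  depend only on the product \<open>u * v\<close>, through a power series that is continuous at \<open>0\<close>.\<close>

lemma taylor_coeff_represented: "\<exists>h\<in>H. \<forall>f\<in>H. ip f h = taylor_coeff f k"
proof (induction k rule: less_induct)
  case (less k)
  hence "\<forall>j. \<exists>h. j < k \<longrightarrow> h \<in> H \<and> (\<forall>f\<in>H. ip f h = taylor_coeff f j)" by blast
  from choice[OF this] obtain h
    where "\<forall>j. j < k \<longrightarrow> h j \<in> H \<and> (\<forall>f\<in>H. ip f (h j) = taylor_coeff f j)" ..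
  hence h: "\<And>j. j < k \<Longrightarrow> h j \<in> H"
      and ip_h: "\<And>j f. j < k \<Longrightarrow> f \<in> H \<Longrightarrow> ip f (h j) = taylor_coeff f j"
    by simp_all
  define g :: "real \<Rightarrow> complex \<Rightarrow> complex" where
    "g u = fscale (1 / of_real u ^ k) (atom l (of_real u) - (\<Sum>j<k. fscale (of_real u ^ j) (h j)))"
    for u
  define q where "q f x = (\<Sum>p. taylor_coeff f (p + k) * x ^ p)" for f and x :: complex
  define \<phi> where "\<phi> x = (\<Sum>p. of_real (kernel_coeff l (p + k)) * x ^ p)" for x :: complex
  have q_sums: "(\<lambda>p. taylor_coeff f (p + k) * x ^ p) sums q f x" if "f \<in> H" "x \<in> unit_disc" for f x
    unfolding q_def
    using taylor_coeff_sums[OF holomorphic[OF that(1)] that(2)]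
    by (intro summable_sums) (simp add: sums_summable summable_powser_ignore_initial_segment)
  have \<phi>_sums: "(\<lambda>p. of_real (kernel_coeff l (p + k)) * x ^ p) sums \<phi> x" if "cmod x < 1" for x
    unfolding \<phi>_def
    using binomial_series[OF that, of l]
    by (intro summable_sums) 
       (simp add: sums_summable summable_powser_ignore_initial_segment[of "\<lambda>p. of_real (kernel_coeff l p)"])
  have g: "g u \<in> H" if "u \<in> {0<..<1}" for u
    unfolding g_def using that by (intro mem_scale mem_diff mem_sum atom_mem) (auto intro: h)
  have ip_g: "ip f (g u) = q f (of_real u)" if f: "f \<in> H" and u: "u \<in> {0<..<1}" for f u
  proof -
    have u': "of_real u \<in> unit_disc" using u by simp
    define s where "s = (\<Sum>j<k. fscale (of_real u ^ j) (h j))"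
    have s: "s \<in> H" unfolding s_def by (intro mem_sum mem_scale h) auto
    have "ip f s = (\<Sum>j<k. ip f (fscale (of_real u ^ j) (h j)))"
      unfolding s_def using f h by (intro ip_sum_right mem_scale) auto
    also have "\<dots> = (\<Sum>j<k. taylor_coeff f j * of_real u ^ j)"
      using f h by (intro sum.cong) (auto simp: ip_scale_right ip_h)
    finally have ip_s: "ip f s = (\<Sum>j<k. taylor_coeff f j * of_real u ^ j)" .
    have "ip f (g u) = 1 / of_real u ^ k * ip f (atom l (of_real u) - s)"
      unfolding g_def s_def[symmetric]
      by (subst ip_scale_right) (auto intro!: mem_diff s atom_mem f u')
    also have "ip f (atom l (of_real u) - s) = ip f (atom l (of_real u)) - ip f s"
      by (intro ip_diff_right atom_mem u' s f)
    finally have "ip f (g u)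
        = (f (of_real u) - (\<Sum>j<k. taylor_coeff f j * of_real u ^ j)) / of_real u ^ k"
      unfolding ip_s ip_atom[OF f u'] by simp
    moreover have "(\<lambda>p. taylor_coeff f (p + k) * of_real u ^ (p + k) / of_real u ^ k)
        sums ((f (of_real u) - (\<Sum>j<k. taylor_coeff f j * of_real u ^ j)) / of_real u ^ k)"
      by (intro sums_divide sums_split_initial_segment taylor_coeff_sums holomorphic f u')
    hence "(\<lambda>p. taylor_coeff f (p + k) * of_real u ^ p)
        sums ((f (of_real u) - (\<Sum>j<k. taylor_coeff f j * of_real u ^ j)) / of_real u ^ k)"
      using u by (simp add: power_add)
    ultimately show ?thesis using sums_unique2[OF q_sums[OF f u']] by metis
  qed
  \<comment> \<open>The reproducing property turns the formula for \<open>ip f (g u)\<close>, applied to an atom \<open>f\<close>, into the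
    values of \<open>g u\<close> itself.\<close>
  have coeff_g: "taylor_coeff (g u) p
      = (if p < k then 0 else of_real (kernel_coeff l p) * of_real u ^ (p - k))"
    if u: "u \<in> {0<..<1}" for u p
  proof (rule taylor_coeff_eqI)
    fix z :: complex assume z: "z \<in> unit_disc"
    hence z': "cnj z \<in> unit_disc" by simp
    have "g u z = cnj (ip (atom l (cnj z)) (g u))"
      using ip_atom[OF g[OF u] z'] ip_commute[OF atom_mem[OF z'] g[OF u]] by simp
    also have "\<dots> = cnj (q (atom l (cnj z)) (of_real u))"
      using u z' by (simp add: ip_g atom_mem)
    finally have "(\<lambda>p. cnj (taylor_coeff (atom l (cnj z)) (p + k) * of_real u ^ p)) sums g u z"
      using q_sums[OF atom_mem[OF z'], of "of_real u"] u by (simp only: sums_cnj) simp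
    hence "(\<lambda>p. of_real (kernel_coeff l (p + k)) * of_real u ^ p * z ^ (p + k)) sums g u z"
      using z' by (simp add: taylor_coeff_atom mult_ac)
    thus "(\<lambda>p. (if p < k then 0 else of_real (kernel_coeff l p) * of_real u ^ (p - k)) * z ^ p)
        sums g u z"
      by (subst sums_zero_iff_shift[where n = k, symmetric]) auto
  qed
  have Gram: "ip (g u) (g v) = \<phi> (of_real (u * v))" if "u \<in> {0<..<1}" "v \<in> {0<..<1}" for u v
    using that by (simp add: ip_g g q_def \<phi>_def coeff_g power_mult_distrib mult_ac)
  define u where "u n = inverse (real (Suc (Suc n)))" for n
  have u: "u n \<in> {0<..<1}" for n by (simp add: u_def field_simps)
  have u_lim: "u \<longlonglongrightarrow> 0" unfolding u_def by (rule LIMSEQ_Suc[OF LIMSEQ_inverse_real_of_nat])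
  have \<phi>_lim: "(\<phi> \<longlongrightarrow> of_real (kernel_coeff l (0 + k))) (at 0)"
    by (rule powser_limit_0[of 1]) (use \<phi>_sums in auto)
  have "\<exists>N. \<forall>m\<ge>N. \<forall>n\<ge>N. cmod (ip (g (u m)) (g (u n)) - of_real (kernel_coeff l k)) < e"
    if e: "e > 0" for e
  proof -
    obtain d where d: "d > 0"
      "\<And>x. x \<noteq> 0 \<Longrightarrow> cmod x < d \<Longrightarrow> cmod (\<phi> x - of_real (kernel_coeff l k)) < e"
      using LIM_D[OF \<phi>_lim e] by auto
    obtain N where N: "\<And>n. n \<ge> N \<Longrightarrow> u n < d"
      using order_tendstoD(2)[OF u_lim d(1)] by (auto simp: eventually_sequentially)
    have "cmod (ip (g (u m)) (g (u n)) - of_real (kernel_coeff l k)) < e" if "m \<ge> N" for m n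
    proof -
      have "u m * u n \<le> u m * 1" using u[of m] u[of n] by (intro mult_left_mono) auto
      hence "u m * u n < d" using N[OF that] by simp
      moreover have "u m * u n > 0" using u[of m] u[of n] by simp
      ultimately show ?thesis using u
        by (subst Gram) (auto intro!: d(2) simp: norm_mult simp del: of_real_mult mult_pos_pos)
    qed
    thus ?thesis by blast
  qed
  from convergent_if_Gram_converges[of "\<lambda>n. g (u n)", OF g[OF u] this]
  obtain h0 where h0: "h0 \<in> H" and lim: "(\<lambda>n. ip_norm ip (g (u n) - h0)) \<longlonglongrightarrow> 0" by blast
  have "ip f h0 = taylor_coeff f k" if f: "f \<in> H" for f
  proof -
    have "(q f \<longlongrightarrow> taylor_coeff f (0 + k)) (at 0)"
      by (rule powser_limit_0[of 1]) (use q_sums[OF f] in auto)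
    moreover have "filterlim (\<lambda>n. complex_of_real (u n)) (at 0) sequentially"
      unfolding filterlim_at using u u_lim
      by (auto simp: tendsto_of_real_iff[where c = 0, simplified] intro!: always_eventually)
         (metis less_irrefl)
    ultimately have "(\<lambda>n. q f (of_real (u n))) \<longlonglongrightarrow> taylor_coeff f k"
      by (auto intro: filterlim_compose)
    hence "(\<lambda>n. cnj (ip f (g (u n)))) \<longlonglongrightarrow> cnj (taylor_coeff f k)"
      using f u by (simp add: ip_g lim_cnj)
    hence "(\<lambda>n. ip (g (u n)) f) \<longlonglongrightarrow> cnj (taylor_coeff f k)"
      by (simp only: ip_commute[OF f g[OF u], symmetric])
    with tendsto_ip_left[OF g[OF u] h0 f lim] have "ip h0 f = cnj (taylor_coeff f k)"
      by (rule LIMSEQ_unique)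
    thus ?thesis using ip_commute[OF h0 f] by simp
  qed
  with h0 show ?case by blast
qed

lemma weighted_monomial_mem: "weighted_monomial l k \<in> H"
  and ip_weighted_monomial: "f \<in> H \<Longrightarrow> ip f (weighted_monomial l k) = taylor_coeff f k"
proof -
  obtain h where h: "h \<in> H" "\<And>f. f \<in> H \<Longrightarrow> ip f h = taylor_coeff f k"
    using taylor_coeff_represented by blast
  have "h = weighted_monomial l k"
  proof
    fix z
    show "h z = weighted_monomial l k z"
    proof (cases "z \<in> unit_disc")
      case True
      hence z: "cnj z \<in> unit_disc" by simp
      have "h z = cnj (ip (atom l (cnj z)) h)"
        using ip_atom[OF h(1) z] ip_commute[OF atom_mem[OF z] h(1)] by simp
      thus ?thesis using z True h(2)[OF atom_mem[OF z]]
        by (simp add: taylor_coeff_atom weighted_monomial_def)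
    qed (simp add: vanishes_off_disc[OF h(1)] weighted_monomial_def)
  qed
  thus "weighted_monomial l k \<in> H" "f \<in> H \<Longrightarrow> ip f (weighted_monomial l k) = taylor_coeff f k"
    using h by simp_all
qed

definition monomial_sum :: "(nat \<Rightarrow> complex) \<Rightarrow> nat set \<Rightarrow> complex \<Rightarrow> complex" where
  "monomial_sum x K = (\<Sum>k\<in>K. fscale (x k / of_real (kernel_coeff l k)) (weighted_monomial l k))"

lemma monomial_sum_mem: "monomial_sum x K \<in> H"
  unfolding monomial_sum_def by (intro mem_sum mem_scale weighted_monomial_mem)

lemma ip_monomial_sum_left:
  assumes "f \<in> H"
  shows "ip (monomial_sum x K) f
    = (\<Sum>k\<in>K. x k * cnj (taylor_coeff f k) / of_real (kernel_coeff l k))"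
  unfolding monomial_sum_def
  using assms by (simp add: ip_sum_left ip_scale_left mem_scale weighted_monomial_mem
      ip_commute[OF assms weighted_monomial_mem] ip_weighted_monomial)

lemma taylor_coeff_monomial_sum:
  assumes "finite K"
  shows "taylor_coeff (monomial_sum x K) j = (if j \<in> K then x j else 0)"
proof -
  have "taylor_coeff (monomial_sum x K) j = ip (monomial_sum x K) (weighted_monomial l j)"
    by (simp add: ip_weighted_monomial monomial_sum_mem)
  also have "\<dots> = (\<Sum>k\<in>K. if k = j then x k else 0)"
    using kernel_coeff_pos[OF l_pos, of j]
    by (auto simp: ip_monomial_sum_left weighted_monomial_mem taylor_coeff_weighted_monomial
        intro!: sum.cong)
  also have "\<dots> = (if j \<in> K then x j else 0)" using assms by simp
  finally show ?thesis .
qed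

lemma ip_monomial_sum:
  assumes "finite K" "finite L"
  shows "ip (monomial_sum x K) (monomial_sum x L)
    = of_real (\<Sum>k\<in>K \<inter> L. (cmod (x k))\<^sup>2 / kernel_coeff l k)"
  unfolding ip_monomial_sum_left[OF monomial_sum_mem] of_real_sum sum.inter_restrict[OF assms(1)]
  using assms complex_norm_square
  by (intro sum.cong) (auto simp: taylor_coeff_monomial_sum)

lemma Bessel:
  assumes f: "f \<in> H" and K: "finite K"
  shows "(\<Sum>k\<in>K. (cmod (taylor_coeff f k))\<^sup>2 / kernel_coeff l k) \<le> (ip_norm ip f)\<^sup>2"
proof -
  let ?v = "monomial_sum (taylor_coeff f) K"
  define B where "B = (\<Sum>k\<in>K. (cmod (taylor_coeff f k))\<^sup>2 / kernel_coeff l k)"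
  have "B \<ge> 0" unfolding B_def
    using kernel_coeff_pos[OF l_pos] by (intro sum_nonneg divide_nonneg_nonneg) (auto intro: less_imp_le)
  have v: "(ip_norm ip ?v)\<^sup>2 = B"
    by (simp add: ip_norm_square monomial_sum_mem ip_monomial_sum K B_def)
  have "ip ?v f = of_real B"
    using f by (auto simp: ip_monomial_sum_left B_def complex_norm_square[symmetric])
  hence "B \<le> ip_norm ip ?v * ip_norm ip f"
    using Cauchy_Schwarz[OF monomial_sum_mem f, of "taylor_coeff f" K] \<open>B \<ge> 0\<close> by simp
  hence "B\<^sup>2 \<le> (ip_norm ip ?v * ip_norm ip f)\<^sup>2"
    using \<open>B \<ge> 0\<close> by (rule power_mono)
  hence "B * B \<le> B * (ip_norm ip f)\<^sup>2"
    by (simp add: power_mult_distrib v) (simp add: power2_eq_square)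
  thus ?thesis using \<open>B \<ge> 0\<close> unfolding B_def[symmetric]
    by (cases "B = 0") auto
qed

text \<open>Together with Bessel's inequality this identifies the space with the power series for which
  \<open>\<Sum>k. (cmod (x k))\<^sup>2 / kernel_coeff l k\<close> is finite.\<close>

lemma Riesz_Fischer:
  assumes "summable (\<lambda>k. (cmod (x k))\<^sup>2 / kernel_coeff l k)"
  obtains f where "f \<in> H" "\<And>k. taylor_coeff f k = x k"
    "(\<lambda>N. ip_norm ip (monomial_sum x {..<N} - f)) \<longlonglongrightarrow> 0"
proof -
  let ?s = "\<lambda>k. (cmod (x k))\<^sup>2 / kernel_coeff l k"
  have "\<exists>N. \<forall>p\<ge>N. \<forall>q\<ge>N. cmod (ip (monomial_sum x {..<p}) (monomial_sum x {..<q}) - of_real (suminf ?s)) < e"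
    if e: "e > 0" for e
  proof -
    obtain N where N: "\<And>n. n \<ge> N \<Longrightarrow> \<bar>(\<Sum>k<n. ?s k) - suminf ?s\<bar> < e"
      using LIMSEQ_D[OF summable_LIMSEQ[OF assms] e] by auto
    have "cmod (ip (monomial_sum x {..<p}) (monomial_sum x {..<q}) - of_real (suminf ?s)) < e"
      if "p \<ge> N" "q \<ge> N" for p q
    proof -
      have "{..<p} \<inter> {..<q} = {..<min p q}" by auto
      hence "ip (monomial_sum x {..<p}) (monomial_sum x {..<q}) = of_real (\<Sum>k<min p q. ?s k)"
        by (simp add: ip_monomial_sum)
      thus ?thesis using N[of "min p q"] that
        by (simp only: of_real_diff[symmetric] norm_of_real)
    qed
    thus ?thesis by blast
  qed
  from convergent_if_Gram_converges[of "\<lambda>N. monomial_sum x {..<N}", OF monomial_sum_mem this]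
  obtain f where f: "f \<in> H" and lim: "(\<lambda>N. ip_norm ip (monomial_sum x {..<N} - f)) \<longlonglongrightarrow> 0"
    by blast
  have "taylor_coeff f k = x k" for k
  proof (rule LIMSEQ_unique)
    show "(\<lambda>N. ip (monomial_sum x {..<N}) (weighted_monomial l k)) \<longlonglongrightarrow> taylor_coeff f k"
      using tendsto_ip_left[OF monomial_sum_mem f weighted_monomial_mem lim, of k]
      by (simp add: ip_weighted_monomial f)
    show "(\<lambda>N. ip (monomial_sum x {..<N}) (weighted_monomial l k)) \<longlonglongrightarrow> x k"
      by (rule tendsto_eventually)
         (auto simp: ip_weighted_monomial monomial_sum_mem taylor_coeff_monomial_sum
            eventually_sequentially intro!: exI[of _ "Suc k"])
  qed
  with f lim that show thesis by blast
qed

text \<open>The partial sums of the Taylor series of \<open>f\<close> converge in norm to some element; it has the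
  coefficients of \<open>f\<close>, hence is \<open>f\<close>.\<close>

lemma ip_sums:
  assumes f: "f \<in> H" and g: "g \<in> H"
  shows "(\<lambda>k. taylor_coeff f k * cnj (taylor_coeff g k) / of_real (kernel_coeff l k)) sums ip f g"
proof -
  have "summable (\<lambda>k. (cmod (taylor_coeff f k))\<^sup>2 / kernel_coeff l k)"
    by (rule bounded_imp_summable[where B = "(ip_norm ip f)\<^sup>2"])
       (use Bessel[OF f] kernel_coeff_pos[OF l_pos] in \<open>auto simp: less_imp_le\<close>)
  then obtain f' where f': "f' \<in> H" "\<And>k. taylor_coeff f' k = taylor_coeff f k"
    "(\<lambda>N. ip_norm ip (monomial_sum (taylor_coeff f) {..<N} - f')) \<longlonglongrightarrow> 0"
    using Riesz_Fischer by blast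
  have "f' = f" by (rule eq_if_taylor_coeff_eq) (use f f' in auto)
  with f' tendsto_ip_left[OF monomial_sum_mem f g] show ?thesis
    by (simp add: sums_def ip_monomial_sum_left g)
qed

lemma ip_norm_sums:
  assumes "f \<in> H"
  shows "(\<lambda>k. (cmod (taylor_coeff f k))\<^sup>2 / kernel_coeff l k) sums (ip_norm ip f)\<^sup>2"
proof -
  have "(\<lambda>k. complex_of_real ((cmod (taylor_coeff f k))\<^sup>2 / kernel_coeff l k))
      sums of_real ((ip_norm ip f)\<^sup>2)"
    using ip_sums[OF assms assms] unfolding ip_self[OF assms]
    by (simp add: complex_norm_square[symmetric])
  thus ?thesis by (simp only: sums_of_real_iff)
qed

end

section \<open>Weighted composition of coefficient sequences\<close>

text \<open>The operators of the theorem act on Taylor coefficients by \<open>x \<mapsto> (\<lambda>k. c k * x (\<sigma> k))\<close>: both shifts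
  and all entries \<open>S i j\<close> are of this form, with \<open>\<sigma>\<close> a shift of the index. As \<open>\<sigma>\<close> need only be injective
  where \<open>c\<close> is nonzero, truncated subtraction is a possible \<open>\<sigma>\<close>.\<close>

definition coeff_op :: "(nat \<Rightarrow> complex) \<Rightarrow> (nat \<Rightarrow> nat) \<Rightarrow> (complex \<Rightarrow> complex) \<Rightarrow> complex \<Rightarrow> complex"
  where "coeff_op c \<sigma> f
    = (\<lambda>z. if z \<in> unit_disc then \<Sum>k. c k * taylor_coeff f (\<sigma> k) * z ^ k else 0)"

definition bounded_between ::
  "('x \<Rightarrow> complex) set \<Rightarrow> 'x inner_product \<Rightarrow> ('x \<Rightarrow> complex) set \<Rightarrow> 'x inner_product
     \<Rightarrow> (('x \<Rightarrow> complex) \<Rightarrow> 'x \<Rightarrow> complex) \<Rightarrow> bool" where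
  "bounded_between H ip H' ip' A \<longleftrightarrow>
     A ` H \<subseteq> H' \<and> linear_on_with fscale fscale H A \<and>
     (\<exists>C\<ge>0. \<forall>f\<in>H. ip_norm ip' (A f) \<le> C * ip_norm ip f)"

locale bounded_coeff_op =
  source: A_space l H ip + target: A_space l' H' ip'
  for l H ip l' H' ip' +
  fixes c :: "nat \<Rightarrow> complex" and \<sigma> :: "nat \<Rightarrow> nat" and C :: real
  assumes inj: "inj_on \<sigma> {k. c k \<noteq> 0}" and C: "C \<ge> 0"
    and bound: "\<And>k. (cmod (c k))\<^sup>2 * kernel_coeff l (\<sigma> k) \<le> C * kernel_coeff l' k"
begin

text \<open>Each term \<open>(cmod (c k * x (\<sigma> k)))\<^sup>2 / kernel_coeff l' k\<close> of the target norm is at most \<open>C\<close> times the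
  term of index \<open>\<sigma> k\<close> of the source norm, and by injectivity no source term is used twice. Hence the
  new coefficients are square summable with the target weights, and the Riesz-Fischer lemma
  provides the image.\<close>

lemma
  assumes f: "f \<in> H"
  shows coeff_op_mem: "coeff_op c \<sigma> f \<in> H'"
    and taylor_coeff_coeff_op: "taylor_coeff (coeff_op c \<sigma> f) k = c k * taylor_coeff f (\<sigma> k)"
    and ip_norm_coeff_op: "ip_norm ip' (coeff_op c \<sigma> f) \<le> sqrt C * ip_norm ip f"
proof -
  define y where "y k = c k * taylor_coeff f (\<sigma> k)" for k
  let ?t = "\<lambda>k. (cmod (taylor_coeff f k))\<^sup>2 / kernel_coeff l k"
  have pos: "kernel_coeff l k > 0" "kernel_coeff l' k > 0" for k
    by (simp_all add: kernel_coeff_pos source.l_pos target.l_pos)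
  have finite_bound: "(\<Sum>k\<in>K. (cmod (y k))\<^sup>2 / kernel_coeff l' k) \<le> C * (ip_norm ip f)\<^sup>2"
    if K: "finite K" for K
  proof -
    let ?L = "K \<inter> {k. c k \<noteq> 0}"
    have "(\<Sum>k\<in>K. (cmod (y k))\<^sup>2 / kernel_coeff l' k) = (\<Sum>k\<in>?L. (cmod (y k))\<^sup>2 / kernel_coeff l' k)"
      using K by (intro sum.mono_neutral_right) (auto simp: y_def)
    also have "\<dots> \<le> (\<Sum>k\<in>?L. C * ?t (\<sigma> k))"
    proof (rule sum_mono)
      fix k
      have "(cmod (y k))\<^sup>2 * kernel_coeff l (\<sigma> k)
          = ((cmod (c k))\<^sup>2 * kernel_coeff l (\<sigma> k)) * (cmod (taylor_coeff f (\<sigma> k)))\<^sup>2"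
        by (simp add: y_def norm_mult power_mult_distrib)
      also have "\<dots> \<le> (C * kernel_coeff l' k) * (cmod (taylor_coeff f (\<sigma> k)))\<^sup>2"
        by (intro mult_right_mono bound) simp
      finally show "(cmod (y k))\<^sup>2 / kernel_coeff l' k \<le> C * ?t (\<sigma> k)"
        using pos(1)[of "\<sigma> k"] pos(2)[of k] by (simp add: field_simps)
    qed
    also have "\<dots> = C * (\<Sum>k\<in>\<sigma> ` ?L. ?t k)"
      using inj by (subst sum.reindex) (auto simp: sum_distrib_left intro: inj_on_subset)
    also have "\<dots> \<le> C * (ip_norm ip f)\<^sup>2"
      using K C by (intro mult_left_mono source.Bessel f) auto
    finally show ?thesis .
  qed
  have summable: "summable (\<lambda>k. (cmod (y k))\<^sup>2 / kernel_coeff l' k)"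
    by (rule bounded_imp_summable[where B = "C * (ip_norm ip f)\<^sup>2"])
       (use finite_bound pos in \<open>auto simp: less_imp_le\<close>)
  then obtain h where h: "h \<in> H'" "\<And>k. taylor_coeff h k = y k"
    by (rule target.Riesz_Fischer) (rule that)
  have h_eq: "h = coeff_op c \<sigma> f"
  proof
    fix z
    show "h z = coeff_op c \<sigma> f z"
      using taylor_coeff_sums[OF target.holomorphic[OF h(1)], of z]
        target.vanishes_off_disc[OF h(1), of z]
      by (cases "z \<in> unit_disc") (simp_all add: coeff_op_def h(2) y_def sums_iff)
  qed
  show "coeff_op c \<sigma> f \<in> H'" and "taylor_coeff (coeff_op c \<sigma> f) k = c k * taylor_coeff f (\<sigma> k)"
    using h by (simp_all add: h_eq y_def)
  have "(\<lambda>k. (cmod (y k))\<^sup>2 / kernel_coeff l' k) sums (ip_norm ip' h)\<^sup>2"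
    using target.ip_norm_sums[OF h(1)] by (simp only: h(2))
  hence "(ip_norm ip' h)\<^sup>2 \<le> C * (ip_norm ip f)\<^sup>2"
    using suminf_le_const[OF summable finite_bound] by (simp only: sums_iff) simp
  also have "\<dots> = (sqrt C * ip_norm ip f)\<^sup>2"
    using C by (simp add: power_mult_distrib)
  finally have "ip_norm ip' h \<le> sqrt C * ip_norm ip f"
    by (rule power2_le_imp_le) (simp add: C source.ip_norm_nonneg[OF f])
  thus "ip_norm ip' (coeff_op c \<sigma> f) \<le> sqrt C * ip_norm ip f" by (simp only: h_eq)
qed

lemma coeff_op_linear: "linear_on_with fscale fscale H (coeff_op c \<sigma>)"
  unfolding linear_on_with_def
proof (intro conjI ballI allI)
  fix f g assume "f \<in> H" "g \<in> H"
  thus "coeff_op c \<sigma> (f + g) = coeff_op c \<sigma> f + coeff_op c \<sigma> g"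
    by (intro target.eq_if_taylor_coeff_eq)
       (simp_all add: target.mem_add source.mem_add coeff_op_mem taylor_coeff_coeff_op
          taylor_coeff_add source.holomorphic target.holomorphic distrib_left)
next
  fix f and b :: complex assume "f \<in> H"
  thus "coeff_op c \<sigma> (fscale b f) = fscale b (coeff_op c \<sigma> f)"
    by (intro target.eq_if_taylor_coeff_eq)
       (simp_all add: target.mem_scale source.mem_scale coeff_op_mem taylor_coeff_coeff_op
          taylor_coeff_fscale source.holomorphic target.holomorphic)
qed

lemma bounded_between_coeff_op: "bounded_between H ip H' ip' (coeff_op c \<sigma>)"
  unfolding bounded_between_def
  using coeff_op_mem coeff_op_linear ip_norm_coeff_op C
  by (intro conjI exI[of _ "sqrt C"] ballI) auto

end

section \<open>The adjoint of multiplication by the coordinate\<close>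

lemma kernel_coeff_Suc:
  "kernel_coeff l (Suc k) = kernel_coeff l k * (l + real k) / (real k + 1)"
  by (simp add: kernel_coeff_def pochhammer_Suc add_ac)

text \<open>The ratio of consecutive coefficients is \<open>(l + k) / (k + 1)\<close>, which for \<open>l < 1\<close> is smallest at
  \<open>k = 0\<close>; for such \<open>l\<close> multiplication by the coordinate is bounded but not contractive.\<close>

lemma kernel_coeff_le_Suc:
  assumes "l > 0"
  shows "kernel_coeff l k \<le> (1 + 1 / l) * kernel_coeff l (Suc k)"
proof -
  have "(real k + 1) * l \<le> (1 + l) * (l + real k)"
    using assms by (simp add: algebra_simps)
  hence "1 \<le> (1 + 1 / l) * ((l + real k) / (real k + 1))"
    using assms by (simp add: add_divide_eq_iff le_divide_eq mult_ac add_ac)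
  from mult_left_mono[OF this, of "kernel_coeff l k"] show ?thesis
    using kernel_coeff_pos[OF assms, of k] by (simp add: kernel_coeff_Suc mult_ac)
qed

definition backward_shift :: "real \<Rightarrow> (complex \<Rightarrow> complex) \<Rightarrow> complex \<Rightarrow> complex" where
  "backward_shift l = coeff_op (\<lambda>k. of_real (kernel_coeff l k / kernel_coeff l (Suc k))) Suc"

context A_space
begin

sublocale forward: bounded_coeff_op l H ip l H ip "\<lambda>k. if k = 0 then 0 else 1" "\<lambda>k. k - 1" "1 + 1 / l"
proof
  show "inj_on (\<lambda>k::nat. k - 1) {k. (if k = 0 then 0 else 1) \<noteq> (0::complex)}"
    by (auto simp: inj_on_def split: if_splits)
  show "0 \<le> 1 + 1 / l" using l_pos by simp
  show "(cmod (if k = 0 then 0 else 1))\<^sup>2 * kernel_coeff l (k - 1) \<le> (1 + 1 / l) * kernel_coeff l k" for k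
    using kernel_coeff_le_Suc[OF l_pos, of "k - 1"] kernel_coeff_pos[OF l_pos, of k] l_pos
    by (cases k) auto
qed

sublocale backward: bounded_coeff_op l H ip l H ip
  "\<lambda>k. of_real (kernel_coeff l k / kernel_coeff l (Suc k))" Suc "1 + 1 / l"
proof
  show "0 \<le> 1 + 1 / l" using l_pos by simp
  fix k
  have "kernel_coeff l k * kernel_coeff l k
      \<le> kernel_coeff l k * ((1 + 1 / l) * kernel_coeff l (Suc k))"
    using kernel_coeff_pos[OF l_pos, of k]
    by (intro mult_left_mono kernel_coeff_le_Suc l_pos) (simp add: less_imp_le)
  thus "(cmod (of_real (kernel_coeff l k / kernel_coeff l (Suc k))))\<^sup>2 * kernel_coeff l (Suc k)
      \<le> (1 + 1 / l) * kernel_coeff l k"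
    using kernel_coeff_pos[OF l_pos, of "Suc k"]
    by (simp only: norm_of_real power2_abs) (simp add: power2_eq_square field_simps)
qed simp

lemma mult_coord_eq:
  assumes "f \<in> H"
  shows "mult_coord f = coeff_op (\<lambda>k. if k = 0 then 0 else 1) (\<lambda>k. k - 1) f"
proof
  fix z
  show "mult_coord f z = coeff_op (\<lambda>k. if k = 0 then 0 else 1) (\<lambda>k. k - 1) f z"
  proof (cases "z \<in> unit_disc")
    case True
    have "(\<lambda>k. z * (taylor_coeff f k * z ^ k)) sums (z * f z)"
      by (intro sums_mult taylor_coeff_sums holomorphic assms True)
    hence "(\<lambda>k. (if k + 1 = 0 then 0 else 1) * taylor_coeff f (k + 1 - 1) * z ^ (k + 1))
        sums (z * f z)"
      by (simp add: mult_ac)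
    hence "(\<lambda>k. (if k = 0 then 0 else 1) * taylor_coeff f (k - 1) * z ^ k) sums (z * f z)"
      by (subst (asm) sums_zero_iff_shift) auto
    thus ?thesis using True by (simp add: mult_coord_def coeff_op_def sums_iff)
  qed (simp add: mult_coord_def coeff_op_def vanishes_off_disc[OF assms])
qed

lemma ip_mult_coord:
  assumes f: "f \<in> H" and g: "g \<in> H"
  shows "ip (mult_coord g) f = ip g (backward_shift l f)"
proof -
  have coeff: "taylor_coeff (mult_coord g) k = (if k = 0 then 0 else 1) * taylor_coeff g (k - 1)" for k
    unfolding mult_coord_eq[OF g] by (rule forward.taylor_coeff_coeff_op[OF g])
  have coeff': "taylor_coeff (backward_shift l f) k
      = of_real (kernel_coeff l k / kernel_coeff l (Suc k)) * taylor_coeff f (Suc k)" for k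
    unfolding backward_shift_def by (rule backward.taylor_coeff_coeff_op[OF f])
  have "(\<lambda>k. taylor_coeff (mult_coord g) k * cnj (taylor_coeff f k) / of_real (kernel_coeff l k))
      sums ip (mult_coord g) f"
    unfolding mult_coord_eq[OF g] by (intro ip_sums forward.coeff_op_mem f g)
  hence "(\<lambda>k. taylor_coeff (mult_coord g) (k + 1) * cnj (taylor_coeff f (k + 1))
      / of_real (kernel_coeff l (k + 1))) sums ip (mult_coord g) f"
    by (subst sums_zero_iff_shift) (simp_all add: coeff)
  hence "(\<lambda>k. taylor_coeff g k * cnj (taylor_coeff f (Suc k)) / of_real (kernel_coeff l (Suc k)))
      sums ip (mult_coord g) f"
    by (simp add: coeff)
  moreover have "(\<lambda>k. taylor_coeff g k * cnj (taylor_coeff (backward_shift l f) k)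
      / of_real (kernel_coeff l k)) sums ip g (backward_shift l f)"
    unfolding backward_shift_def by (intro ip_sums backward.coeff_op_mem f g)
  moreover have "taylor_coeff g k * cnj (taylor_coeff (backward_shift l f) k)
      / of_real (kernel_coeff l k)
      = taylor_coeff g k * cnj (taylor_coeff f (Suc k)) / of_real (kernel_coeff l (Suc k))" for k
    using kernel_coeff_pos[OF l_pos, of k] kernel_coeff_pos[OF l_pos, of "Suc k"]
    unfolding coeff' by (simp add: field_simps)
  ultimately show ?thesis by (simp add: sums_iff)
qed

text \<open>The definite description in the adjoint needs uniqueness as well: two candidates have the same
  inner product with every element, in particular with their difference.\<close>

lemma adjoint_mult_coord:
  assumes f: "f \<in> H"
  shows "adjoint_op H ip mult_coord f = backward_shift l f"
  unfolding adjoint_op_def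
proof (rule the_equality)
  have mem: "backward_shift l f \<in> H"
    unfolding backward_shift_def by (rule backward.coeff_op_mem[OF f])
  show "backward_shift l f \<in> H \<and> (\<forall>g\<in>H. ip (mult_coord g) f = ip g (backward_shift l f))"
    using mem ip_mult_coord[OF f] by simp
  fix h assume h: "h \<in> H \<and> (\<forall>g\<in>H. ip (mult_coord g) f = ip g h)"
  define d where "d = h - backward_shift l f"
  have d: "d \<in> H" unfolding d_def using h mem by (simp add: mem_diff)
  have "ip d h = ip d (backward_shift l f)" using h d ip_mult_coord[OF f d] by metis
  hence "ip d (h - backward_shift l f) = 0" using h mem d by (simp add: ip_diff_right)
  hence "d = 0" using ip_self_eq_0D[OF d] by (simp only: d_def[symmetric])
  thus "h = backward_shift l f" by (simp add: d_def)
qed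

end

section \<open>Derivatives of atoms\<close>

lemma atom_deriv_eq:
  assumes "w \<in> unit_disc"
  shows "atom_deriv r l w z = of_real (pochhammer l r) * z ^ r * atom (l + real r) w z"
proof (cases "z \<in> unit_disc")
  case False
  have "(deriv ^^ r) (\<lambda>u. 0) = (\<lambda>u::complex. 0::complex)" by (induction r) auto
  with False show ?thesis by (simp add: atom_deriv_def atom_def)
next
  case z: True
  let ?G = "\<lambda>r w. of_real (pochhammer l r) * z ^ r * (1 - z * w) powr (- of_real (l + real r))"
  have "(deriv ^^ r) (\<lambda>u. atom l u z) w = ?G r w" using assms
  proof (induction r arbitrary: w)
    case 0
    thus ?case using z by (simp add: atom_def)
  next
    case (Suc r)
    have "cmod (z * w) < 1" using norm_mult_unit_disc[OF z Suc.prems] .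
    hence "Re (1 - z * w) > 0" using complex_Re_le_cmod[of "z * w"] by simp
    hence nonneg: "1 - z * w \<notin> \<real>\<^sub>\<le>\<^sub>0" by (auto simp: complex_nonpos_Reals_iff)
    have "(?G r has_field_derivative of_real (pochhammer l r) * z ^ r *
        (- of_real (l + real r) * (1 - z * w) powr (- of_real (l + real r) - 1) * (- z))) (at w)"
      by (intro DERIV_cmult DERIV_chain2[where f = "\<lambda>x. x powr (- of_real (l + real r))"
            and g = "\<lambda>u. 1 - z * u"] has_field_derivative_powr[OF nonneg])
         (auto intro!: derivative_eq_intros)
    hence "((deriv ^^ r) (\<lambda>u. atom l u z) has_field_derivative of_real (pochhammer l r) * z ^ r *
        (- of_real (l + real r) * (1 - z * w) powr (- of_real (l + real r) - 1) * (- z))) (at w)"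
      by (rule has_field_derivative_transform_within_open[where S = unit_disc])
         (use Suc in simp_all)
    hence "(deriv ^^ Suc r) (\<lambda>u. atom l u z) w = of_real (pochhammer l r) * z ^ r *
        (- of_real (l + real r) * (1 - z * w) powr (- of_real (l + real r) - 1) * (- z))"
      by (simp add: DERIV_imp_deriv)
    also have "- complex_of_real (l + real r) - 1 = - of_real (l + real (Suc r))" by simp
    also have "of_real (pochhammer l r) * z ^ r *
        (- of_real (l + real r) * (1 - z * w) powr (- of_real (l + real (Suc r))) * (- z)) = ?G (Suc r) w"
      by (simp only: pochhammer_Suc of_real_mult power_Suc minus_mult_left[symmetric]
          minus_mult_right[symmetric] minus_minus mult_ac)
    finally show ?case .
  qed
  thus ?thesis using z by (simp add: atom_deriv_def atom_def)
qed

text \<open>The quotient of the two sides has consecutive ratios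
  \<open>(a + p) * (b + p) / ((1 + p) * (c + p))\<close>. Under the hypothesis \<open>c \<ge> a + b - 1\<close> the terms linear in \<open>p\<close>
  do not exceed those of the denominator, so the ratio is at most \<open>1 + K / (p + 1)\<^sup>2\<close>, and the product
  of these ratios is bounded by the exponential of a convergent series.\<close>

lemma pochhammer_product_le:
  fixes a b c :: real
  assumes a: "a > 0" and b: "b \<ge> 1" and c: "c \<ge> a + b - 1"
  obtains C where "C > 0" "\<And>p. pochhammer a p * pochhammer b p \<le> C * (fact p * pochhammer c p)"
proof -
  define K where "K = a * b / min c 1"
  define s where "s p = (\<Sum>q<p. 1 / (real q + 1)\<^sup>2)" for p
  have c_pos: "c > 0" using assms by linarith
  have K: "K \<ge> 0" using a b c_pos by (simp add: K_def)
  have factor: "(a + real p) * (b + real p) \<le> exp (K * (1 / (real p + 1)\<^sup>2)) * ((real p + 1) * (c + real p))" for p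
  proof -
    have "min c 1 * (real p + 1) \<le> c + real p"
    proof -
      have "min c 1 * real p \<le> 1 * real p" by (intro mult_right_mono) auto
      thus ?thesis by (simp add: distrib_left add_mono add.commute)
    qed
    hence "a * b * (min c 1 * (real p + 1)) \<le> a * b * (c + real p)"
      using a b by (intro mult_left_mono) auto
    moreover have "min c 1 * (real p + 1) > 0" using c_pos by simp
    ultimately have "a * b \<le> a * b * (c + real p) / (min c 1 * (real p + 1))"
      by (simp only: pos_le_divide_eq)
    hence "a * b \<le> K * (c + real p) / (real p + 1)"
      by (simp add: K_def)
    also have "\<dots> = (K * (1 / (real p + 1)\<^sup>2)) * ((real p + 1) * (c + real p))"
      by (simp add: power2_eq_square)
    finally have ab: "a * b \<le> (K * (1 / (real p + 1)\<^sup>2)) * ((real p + 1) * (c + real p))" .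
    have "(a + b) * real p \<le> (c + 1) * real p" using c by (intro mult_right_mono) auto
    hence "(a + real p) * (b + real p) \<le> a * b + (real p + 1) * (c + real p)"
      using c_pos by (simp add: algebra_simps)
    also have "\<dots> \<le> (1 + K * (1 / (real p + 1)\<^sup>2)) * ((real p + 1) * (c + real p))"
      using ab by (simp add: distrib_right)
    also have "\<dots> \<le> exp (K * (1 / (real p + 1)\<^sup>2)) * ((real p + 1) * (c + real p))"
      using c_pos by (intro mult_right_mono exp_ge_add_one_self) simp
    finally show ?thesis .
  qed
  have partial: "pochhammer a p * pochhammer b p \<le> exp (K * s p) * (fact p * pochhammer c p)" for p
  proof (induction p)
    case 0
    thus ?case by (simp add: s_def)
  next
    case (Suc p)
    have "(pochhammer a p * pochhammer b p) * ((a + real p) * (b + real p))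
        \<le> (exp (K * s p) * (fact p * pochhammer c p)) *
          (exp (K * (1 / (real p + 1)\<^sup>2)) * ((real p + 1) * (c + real p)))"
      using a b c_pos
      by (intro mult_mono Suc.IH factor)
         (auto intro!: mult_nonneg_nonneg less_imp_le[OF pochhammer_pos])
    also have "\<dots> = exp (K * s (Suc p)) * (fact (Suc p) * pochhammer c (Suc p))"
      by (simp only: s_def sum.lessThan_Suc distrib_left[of K] exp_add pochhammer_Suc fact_Suc
          of_nat_Suc mult_ac add_ac)
    finally show ?case by (simp add: pochhammer_Suc mult_ac)
  qed
  have s: "s p \<le> pi\<^sup>2 / 6" for p
  proof -
    have squares: "(\<lambda>q. 1 / (real q + 1)\<^sup>2) sums (pi\<^sup>2 / 6)"
      using inverse_squares_sums by (simp add: add.commute)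
    have "(\<Sum>q<p. 1 / (real q + 1)\<^sup>2) \<le> (\<Sum>q. 1 / (real q + 1)\<^sup>2)"
      by (intro sum_le_suminf sums_summable[OF squares]) auto
    also have "\<dots> = pi\<^sup>2 / 6"
      by (rule sums_unique[OF squares, symmetric])
    finally show ?thesis by (simp add: s_def)
  qed
  show thesis
  proof (rule that[of "exp (K * (pi\<^sup>2 / 6))"])
    fix p
    have "pochhammer c p > 0" using c_pos by (rule pochhammer_pos)
    hence "exp (K * s p) * (fact p * pochhammer c p) \<le> exp (K * (pi\<^sup>2 / 6)) * (fact p * pochhammer c p)"
      using mult_left_mono[OF s[of p] K] by (intro mult_right_mono) auto
    with partial[of p] show "pochhammer a p * pochhammer b p
        \<le> exp (K * (pi\<^sup>2 / 6)) * (fact p * pochhammer c p)" by linarith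
  qed simp
qed

text \<open>The left-hand side divided by the bracket on the right is the squared weight of the map sending the
  atom of weight \<open>l'\<close> to the \<open>r\<close>-th derivative of the atom of weight \<open>l\<close>. It grows like
  \<open>p powr (l + 2 * r - l')\<close>, which is where the condition on \<open>l'\<close> comes from.\<close>

lemma kernel_coeff_derivative_bound:
  fixes l l' :: real and r :: nat
  assumes l: "l > 0" and l': "l' \<ge> l + 2 * real r"
  obtains C where "C > 0"
    "\<And>p. (pochhammer l r * kernel_coeff (l + real r) p)\<^sup>2
        \<le> C * (kernel_coeff l' p * kernel_coeff l (p + r))"
proof -
  obtain C where C: "C > 0" and bound: "\<And>p. pochhammer (l + real r) p * pochhammer (1 + real r) p
      \<le> C * (fact p * pochhammer l' p)"
    by (rule pochhammer_product_le[of "l + real r" "1 + real r" l']) (use l l' in auto)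
  let ?L = "pochhammer l r"
  have L: "?L > 0" using l by (rule pochhammer_pos)
  have "(?L * kernel_coeff (l + real r) p)\<^sup>2
      \<le> ?L * fact r * C * (kernel_coeff l' p * kernel_coeff l (p + r))" for p
  proof -
    have fact_eq: "fact (p + r) = fact r * pochhammer (1 + real r) p"
      using pochhammer_product'[of "1::real" r p] by (simp add: pochhammer_fact add.commute)
    have poch_eq: "pochhammer l (p + r) = ?L * pochhammer (l + real r) p"
      using pochhammer_product'[of l r p] by (simp add: add.commute)
    let ?A = "pochhammer (l + real r) p" and ?B = "pochhammer (1 + real r) p"
    have A: "?A > 0" and B: "?B > 0" using l by (auto intro!: pochhammer_pos)
    have "(?L * kernel_coeff (l + real r) p)\<^sup>2
        = ?L\<^sup>2 * ?A / ((fact p)\<^sup>2 * ?B) * (?A * ?B)"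
      using B by (simp add: kernel_coeff_def power2_eq_square)
    also have "\<dots> \<le> ?L\<^sup>2 * ?A / ((fact p)\<^sup>2 * ?B) * (C * (fact p * pochhammer l' p))"
      using A B by (intro mult_left_mono bound) simp
    also have "\<dots> = ?L * fact r * C * (kernel_coeff l' p * kernel_coeff l (p + r))"
      using B by (simp add: kernel_coeff_def fact_eq poch_eq power2_eq_square)
    finally show ?thesis .
  qed
  with C L show thesis by (intro that[of "?L * fact r * C"]) auto
qed

text \<open>The coefficient of \<open>z\<^sup>k\<close> in \<open>atom l' w\<close> is \<open>kernel_coeff l' k * w\<^sup>k\<close>, and in the \<open>r\<close>-th derivative of
  \<open>atom l w\<close> it is \<open>pochhammer l r * kernel_coeff (l + r) (k - r) * w\<^sup>k\<^sup>-\<^sup>r\<close> for \<open>k \<ge> r\<close>. Both involve \<open>w\<close>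
  only through a power, so one operator, with weights free of \<open>w\<close>, maps every atom to its multiple of
  a derivative.\<close>

definition deriv_op :: "nat \<Rightarrow> real \<Rightarrow> real \<Rightarrow> complex \<Rightarrow> (complex \<Rightarrow> complex) \<Rightarrow> complex \<Rightarrow> complex" where
  "deriv_op r l l' m = coeff_op
     (\<lambda>k. if k < r then 0
       else m * of_real (pochhammer l r * kernel_coeff (l + real r) (k - r) / kernel_coeff l' (k - r)))
     (\<lambda>k. k - r)"

lemma deriv_op_atom:
  assumes l': "l' > 0" and w: "w \<in> unit_disc"
  shows "deriv_op r l l' m (atom l' w) = fscale m (atom_deriv r l w)"
proof
  fix z
  let ?c = "\<lambda>k. if k < r then 0
    else m * of_real (pochhammer l r * kernel_coeff (l + real r) (k - r) / kernel_coeff l' (k - r))"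
  show "deriv_op r l l' m (atom l' w) z = fscale m (atom_deriv r l w) z"
  proof (cases "z \<in> unit_disc")
    case True
    have "(\<lambda>p. m * of_real (pochhammer l r) * z ^ r *
        (of_real (kernel_coeff (l + real r) p) * w ^ p * z ^ p))
      sums (m * of_real (pochhammer l r) * z ^ r * atom (l + real r) w z)"
      by (intro sums_mult atom_sums True w)
    moreover have "m * of_real (pochhammer l r) * z ^ r *
        (of_real (kernel_coeff (l + real r) p) * w ^ p * z ^ p)
      = ?c (p + r) * taylor_coeff (atom l' w) (p + r - r) * z ^ (p + r)" for p
      using kernel_coeff_pos[OF l', of p] by (simp add: taylor_coeff_atom[OF w] power_add)
    ultimately have "(\<lambda>p. ?c (p + r) * taylor_coeff (atom l' w) (p + r - r) * z ^ (p + r))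
      sums fscale m (atom_deriv r l w) z"
      by (simp only: fscale_def atom_deriv_eq[OF w] mult.assoc)
    hence "(\<lambda>k. ?c k * taylor_coeff (atom l' w) (k - r) * z ^ k)
      sums fscale m (atom_deriv r l w) z"
      by (subst (asm) sums_zero_iff_shift) auto
    thus ?thesis using True by (simp add: deriv_op_def coeff_op_def sums_iff)
  qed (simp add: deriv_op_def coeff_op_def fscale_def atom_deriv_eq[OF w] atom_def)
qed

lemma bounded_between_deriv_op:
  assumes "A_space l' H' ip'" "A_space l H ip" and l': "l' \<ge> l + 2 * real r"
  shows "bounded_between H' ip' H ip (deriv_op r l l' m)"
proof -
  interpret source: A_space l' H' ip' by fact
  interpret target: A_space l H ip by fact
  let ?c = "\<lambda>k. if k < r then 0
    else m * of_real (pochhammer l r * kernel_coeff (l + real r) (k - r) / kernel_coeff l' (k - r))"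
  obtain C where C: "C > 0" and bound: "\<And>p. (pochhammer l r * kernel_coeff (l + real r) p)\<^sup>2
        \<le> C * (kernel_coeff l' p * kernel_coeff l (p + r))"
    by (rule kernel_coeff_derivative_bound[OF target.l_pos l']) (rule that)
  interpret bounded_coeff_op l' H' ip' l H ip ?c "\<lambda>k. k - r" "(cmod m)\<^sup>2 * C"
  proof
    show "inj_on (\<lambda>k. k - r) {k. ?c k \<noteq> 0}" by (auto simp: inj_on_def split: if_splits)
    show "0 \<le> (cmod m)\<^sup>2 * C" using C by simp
    fix k
    show "(cmod (?c k))\<^sup>2 * kernel_coeff l' (k - r) \<le> (cmod m)\<^sup>2 * C * kernel_coeff l k"
    proof (cases "k < r")
      case True
      thus ?thesis using C kernel_coeff_pos[OF target.l_pos, of k] by simp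
    next
      case False
      let ?u = "pochhammer l r * kernel_coeff (l + real r) (k - r)" and ?v = "kernel_coeff l' (k - r)"
      have v: "?v > 0" by (rule kernel_coeff_pos[OF source.l_pos])
      have "(cmod (?c k))\<^sup>2 * ?v = (cmod m)\<^sup>2 * (?u\<^sup>2 / ?v)"
        using v unfolding if_not_P[OF False] norm_mult norm_of_real power_mult_distrib[of "cmod m"] power2_abs
        by (simp add: power_divide power2_eq_square)
      also have "\<dots> \<le> (cmod m)\<^sup>2 * (C * (?v * kernel_coeff l (k - r + r)) / ?v)"
        using v by (intro mult_left_mono divide_right_mono bound) auto
      finally show ?thesis using False v by simp
    qed
  qed
  show ?thesis using bounded_between_coeff_op by (simp only: deriv_op_def)
qed

section \<open>Operator matrices on finite direct sums\<close>

lemma direct_sum_norm_component: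
  assumes "j < n"
  shows "\<bar>ip_norm (ip j) (F j)\<bar> \<le> direct_sum_norm n ip F"
  using assms member_le_sum[of j "{..<n}" "\<lambda>i. (ip_norm (ip i) (F i))\<^sup>2"]
  unfolding direct_sum_norm_def by (intro real_le_rsqrt) simp

definition matrix_op :: "nat \<Rightarrow> (nat \<Rightarrow> nat \<Rightarrow> ('x \<Rightarrow> complex) \<Rightarrow> 'x \<Rightarrow> complex)
    \<Rightarrow> (nat \<Rightarrow> 'x \<Rightarrow> complex) \<Rightarrow> nat \<Rightarrow> 'x \<Rightarrow> complex" where
  "matrix_op n A F = (\<lambda>i. if i < n then \<Sum>j<n. A i j (F j) else 0)"

lemma upper_triangular_op_eq_matrix_op:
  "upper_triangular_op n T S = matrix_op n (\<lambda>i j. if j < i then \<lambda>f. 0 else if j = i then T i else S i j)"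
proof (intro ext[of "upper_triangular_op n T S"] ext[of "upper_triangular_op n T S _"])
  fix F i
  let ?A = "\<lambda>j. (if j < i then \<lambda>f. 0 else if j = i then T i else S i j) (F j)"
  show "upper_triangular_op n T S F i
    = matrix_op n (\<lambda>i j. if j < i then \<lambda>f. 0 else if j = i then T i else S i j) F i"
  proof (cases "i < n")
    case True
    have "(\<Sum>j<n. ?A j) = (\<Sum>j\<in>insert i {i<..<n}. ?A j)"
      using True by (intro sum.mono_neutral_right) auto
    also have "\<dots> = T i (F i) + (\<Sum>j\<in>{i<..<n}. S i j (F j))"
      by (subst sum.insert) (auto intro!: sum.cong)
    finally show ?thesis using True by (simp only: upper_triangular_op_def matrix_op_def if_True)
  qed (simp add: upper_triangular_op_def matrix_op_def)
qed

lemma bounded_matrix_op: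
  assumes H: "\<And>i. i < n \<Longrightarrow> function_inner_product (H i) (ip i)"
    and A: "\<And>i j. i < n \<Longrightarrow> j < n \<Longrightarrow> bounded_between (H j) (ip j) (H i) (ip i) (A i j)"
    and agree: "\<And>F. F \<in> D \<Longrightarrow> matrix_op n A F = T F"
  shows "bounded_on_direct_sum n H ip D T"
proof -
  let ?B = "matrix_op n A"
  have mem: "A i j f \<in> H i" if "i < n" "j < n" "f \<in> H j" for i j f
    using A[OF that(1,2)] that(3) unfolding bounded_between_def by (auto simp del: image_subset_iff)
  have add: "A i j (f + g) = A i j f + A i j g" if "i < n" "j < n" "f \<in> H j" "g \<in> H j" for i j f g
    using A[OF that(1,2)] that(3,4) unfolding bounded_between_def linear_on_with_def by simp
  have scale: "A i j (fscale c f) = fscale c (A i j f)" if "i < n" "j < n" "f \<in> H j" for i j f c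
    using A[OF that(1,2)] that(3) unfolding bounded_between_def linear_on_with_def by simp
  have "\<forall>i j. \<exists>C. i < n \<longrightarrow> j < n \<longrightarrow> C \<ge> 0 \<and> (\<forall>f\<in>H j. ip_norm (ip i) (A i j f) \<le> C * ip_norm (ip j) f)"
    using A unfolding bounded_between_def by meson
  then obtain C where C: "\<And>i j. i < n \<Longrightarrow> j < n \<Longrightarrow> C i j \<ge> (0::real)"
    "\<And>i j f. i < n \<Longrightarrow> j < n \<Longrightarrow> f \<in> H j \<Longrightarrow> ip_norm (ip i) (A i j f) \<le> C i j * ip_norm (ip j) f"
    by metis
  have maps: "?B ` direct_sum n H \<subseteq> direct_sum n H"
  proof (rule image_subsetI)
    fix F assume F: "F \<in> direct_sum n H"
    have "(\<Sum>j<n. A i j (F j)) \<in> H i" if "i < n" for i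
      by (rule function_inner_product.mem_sum[OF H[OF that]]) (use F that mem in \<open>auto simp: direct_sum_def\<close>)
    thus "?B F \<in> direct_sum n H" by (simp add: direct_sum_def matrix_op_def)
  qed
  have "linear_on_with sum_scale sum_scale (direct_sum n H) ?B"
    unfolding linear_on_with_def
  proof (intro conjI ballI allI)
    fix F G assume FG: "F \<in> direct_sum n H" "G \<in> direct_sum n H"
    show "?B (F + G) = ?B F + ?B G"
    proof
      fix i
      have "(\<Sum>j<n. A i j (F j + G j)) = (\<Sum>j<n. A i j (F j)) + (\<Sum>j<n. A i j (G j))" if "i < n"
        unfolding sum.distrib[symmetric]
        by (intro sum.cong refl add that) (use FG in \<open>auto simp: direct_sum_def\<close>)
      thus "?B (F + G) i = (?B F + ?B G) i" by (simp only: matrix_op_def plus_fun_apply) simp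
    qed
  next
    fix c F assume F: "F \<in> direct_sum n H"
    show "?B (sum_scale c F) = sum_scale c (?B F)"
    proof
      fix i
      have "(\<Sum>j<n. A i j (fscale c (F j))) = fscale c (\<Sum>j<n. A i j (F j))" if "i < n"
        unfolding fun_space.scale_sum_right
        by (intro sum.cong refl scale that) (use F in \<open>auto simp: direct_sum_def\<close>)
      thus "?B (sum_scale c F) i = sum_scale c (?B F) i"
        by (simp add: matrix_op_def sum_scale_def)
    qed
  qed
  moreover have "direct_sum_norm n ip (?B F) \<le> sqrt (\<Sum>i<n. (\<Sum>j<n. C i j)\<^sup>2) * direct_sum_norm n ip F"
    if F: "F \<in> direct_sum n H" for F
  proof -
    let ?N = "direct_sum_norm n ip F"
    have N: "?N \<ge> 0" unfolding direct_sum_norm_def by (intro real_sqrt_ge_zero sum_nonneg) simp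
    have "(ip_norm (ip i) (?B F i))\<^sup>2 \<le> ((\<Sum>j<n. C i j) * ?N)\<^sup>2" if i: "i < n" for i
    proof -
      interpret function_inner_product "H i" "ip i" by (rule H[OF i])
      have AF: "A i j (F j) \<in> H i" if "j < n" for j
        using F that by (intro mem i) (auto simp: direct_sum_def)
      have "ip_norm (ip i) (?B F i) \<le> (\<Sum>j<n. ip_norm (ip i) (A i j (F j)))"
        using i ip_norm_sum_le[of "{..<n}" "\<lambda>j. A i j (F j)"] AF by (simp add: matrix_op_def)
      also have "\<dots> \<le> (\<Sum>j<n. C i j * ?N)"
      proof (rule sum_mono)
        fix j assume j: "j \<in> {..<n}"
        hence "ip_norm (ip i) (A i j (F j)) \<le> C i j * ip_norm (ip j) (F j)"
          using F i by (intro C) (auto simp: direct_sum_def)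
        also have "\<dots> \<le> C i j * ?N"
          using j i C(1) direct_sum_norm_component[of j n ip F] by (intro mult_left_mono) auto
        finally show "ip_norm (ip i) (A i j (F j)) \<le> C i j * ?N" .
      qed
      also have "\<dots> = (\<Sum>j<n. C i j) * ?N" by (simp only: sum_distrib_right)
      finally have le: "ip_norm (ip i) (?B F i) \<le> (\<Sum>j<n. C i j) * ?N" .
      have "?B F i \<in> H i" using maps F i by (auto simp: direct_sum_def)
      from power_mono[OF le ip_norm_nonneg[OF this]] show ?thesis .
    qed
    hence "(\<Sum>i<n. (ip_norm (ip i) (?B F i))\<^sup>2) \<le> (\<Sum>i<n. ((\<Sum>j<n. C i j) * ?N)\<^sup>2)"
      by (intro sum_mono) simp
    also have "\<dots> = (\<Sum>i<n. (\<Sum>j<n. C i j)\<^sup>2) * ?N\<^sup>2"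
      by (simp only: power_mult_distrib sum_distrib_right[symmetric])
    finally have "sqrt (\<Sum>i<n. (ip_norm (ip i) (?B F i))\<^sup>2) \<le> sqrt ((\<Sum>i<n. (\<Sum>j<n. C i j)\<^sup>2) * ?N\<^sup>2)"
      by (rule real_sqrt_le_mono)
    also have "\<dots> = sqrt (\<Sum>i<n. (\<Sum>j<n. C i j)\<^sup>2) * ?N"
      using N by (simp add: real_sqrt_mult)
    finally show ?thesis by (simp only: direct_sum_norm_def[of n ip "?B F"])
  qed
  ultimately show ?thesis
    unfolding bounded_on_direct_sum_def using maps agree
    by (intro exI[of _ ?B] exI[of _ "sqrt (\<Sum>i<n. (\<Sum>j<n. C i j)\<^sup>2)"] conjI ballI) simp_all
qed

section \<open>Boundedness of the upper triangular operator\<close>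

lemma (in A_space) atom_span_subset: "atom_span l \<subseteq> H"
  unfolding atom_span_def
  by (rule fun_space.span_minimal[OF _ subspace]) (auto intro: atom_mem)

lemma linear_on_with_0:
  assumes L: "linear_on_with fscale fscale V L" and V: "0 \<in> V"
  shows "L 0 = 0"
proof -
  have "L (fscale 0 0) = fscale 0 (L 0)"
    by (rule L[unfolded linear_on_with_def, THEN conjunct2, rule_format, OF V])
  thus ?thesis by (simp only: fun_space.scale_zero_left)
qed

text \<open>The entries \<open>S i j\<close> are known only on finite combinations of atoms. By linearity it is enough to
  compare them on single atoms with the operators built above.\<close>

lemma eq_on_atom_span:
  assumes A: "linear_on_with fscale fscale (atom_span l) A"
    and B: "linear_on_with fscale fscale (atom_span l) B"
    and atoms: "\<And>w. w \<in> unit_disc \<Longrightarrow> A (atom l w) = B (atom l w)"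
    and f: "f \<in> atom_span l"
  shows "A f = B f"
proof -
  have sub: "fun_space.subspace (atom_span l)"
    unfolding atom_span_def by (rule fun_space.subspace_span)
  note zero = linear_on_with_0[OF _ fun_space.subspace_0[OF sub]]
  have "fun_space.subspace {f \<in> atom_span l. A f = B f}"
  proof (rule fun_space.subspaceI)
    show "0 \<in> {f \<in> atom_span l. A f = B f}"
      using zero[OF A] zero[OF B] fun_space.subspace_0[OF sub] by simp
    show "f + g \<in> {f \<in> atom_span l. A f = B f}"
      if "f \<in> {f \<in> atom_span l. A f = B f}" "g \<in> {f \<in> atom_span l. A f = B f}" for f g
      using that A B fun_space.subspace_add[OF sub] unfolding linear_on_with_def by simp
    show "fscale c f \<in> {f \<in> atom_span l. A f = B f}"
      if "f \<in> {f \<in> atom_span l. A f = B f}" for c f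
      using that A B fun_space.subspace_scale[OF sub] unfolding linear_on_with_def by simp
  qed
  moreover have "atom l ` unit_disc \<subseteq> {f \<in> atom_span l. A f = B f}"
    using atoms fun_space.span_superset[of "atom l ` unit_disc"] by (auto simp: atom_span_def)
  ultimately have "atom_span l \<subseteq> {f \<in> atom_span l. A f = B f}"
    using fun_space.span_minimal by (metis atom_span_def)
  thus ?thesis using f by blast
qed

lemma (in A_space) ip_norm_atom_of_real:
  assumes s: "s \<in> {0<..<1}"
  shows "ip_norm ip (atom l (of_real s)) = (1 - s\<^sup>2) powr (- (l / 2))"
proof -
  have w: "complex_of_real s \<in> unit_disc" using s by simp
  have x: "1 - s\<^sup>2 > 0" using s by (simp add: power_less_one_iff abs_square_less_1)
  have "atom l (of_real s) (of_real s) = (complex_of_real (1 - s\<^sup>2)) powr of_real (- l)"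
    using w by (simp add: atom_def power2_eq_square)
  also have "\<dots> = of_real ((1 - s\<^sup>2) powr (- l))"
    using x by (intro powr_of_real) simp
  finally have "ip (atom l (of_real s)) (atom l (of_real s)) = of_real ((1 - s\<^sup>2) powr (- l))"
    using ip_atom[OF atom_mem[OF w] w] by simp
  hence "(ip_norm ip (atom l (of_real s)))\<^sup>2 = (1 - s\<^sup>2) powr (- l)"
    unfolding ip_norm_square[OF atom_mem[OF w]] by simp
  also have "\<dots> = ((1 - s\<^sup>2) powr (- (l / 2)))\<^sup>2"
    using x by (simp add: power2_eq_square flip: powr_add)
  finally show ?thesis
    by (rule power2_eq_imp_eq[OF _ ip_norm_nonneg[OF atom_mem[OF w]]]) simp
qed

text \<open>The bound on point evaluation that comes from the reproducing property: the evaluation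
  vector at \<open>s\<close> is an atom, whose norm is the value of the kernel on the diagonal.\<close>

lemma (in A_space) norm_le_ip_norm:
  assumes f: "f \<in> H" and s: "s \<in> {0<..<1}"
  shows "cmod (f (of_real s)) \<le> ip_norm ip f * (1 - s\<^sup>2) powr (- (l / 2))"
proof -
  have w: "complex_of_real s \<in> unit_disc" using s by simp
  show ?thesis
    using Cauchy_Schwarz[OF f atom_mem[OF w]] by (simp add: ip_atom[OF f w] ip_norm_atom_of_real[OF s])
qed

lemma norm_atom_deriv_of_real:
  assumes l: "l > 0" and s: "s \<in> {0<..<1}"
  shows "cmod (atom_deriv r l (of_real s) (of_real s))
    = pochhammer l r * s ^ r * (1 - s\<^sup>2) powr (- (l + real r))"
proof -
  have w: "complex_of_real s \<in> unit_disc" using s by simp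
  have x: "1 - s\<^sup>2 > 0" using s by (simp add: power_less_one_iff abs_square_less_1)
  have "atom (l + real r) (of_real s) (of_real s)
      = (complex_of_real (1 - s\<^sup>2)) powr of_real (- (l + real r))"
    using w by (simp add: atom_def power2_eq_square)
  also have "\<dots> = of_real ((1 - s\<^sup>2) powr (- (l + real r)))"
    using x by (intro powr_of_real) simp
  finally show ?thesis
    using s pochhammer_pos[OF l, of r]
    by (simp add: atom_deriv_eq[OF w] norm_mult norm_power)
qed

text \<open>This is the necessary condition. At \<open>s\<close> the derivative of the atom has size
  \<open>(1 - s\<^sup>2) powr (- (l + r))\<close>, while a bounded operator with values in the space of weight \<open>l\<close> that
  starts from the atom of weight \<open>l'\<close> only allows \<open>(1 - s\<^sup>2) powr (- (l + l') / 2)\<close>. For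
  \<open>l' < l + 2 r\<close> the first exponent is the more singular one, so letting \<open>s\<close> tend to \<open>1\<close> leaves
  no room for a nonzero factor \<open>m\<close>.\<close>

lemma zero_if_norm_bound:
  fixes m :: complex and l l' C :: real
  assumes l: "l > 0" and l': "l' < l + 2 * real r"
    and bound: "\<And>s. s \<in> {0<..<1} \<Longrightarrow>
      cmod m * cmod (atom_deriv r l (of_real s) (of_real s))
        \<le> C * (1 - s\<^sup>2) powr (- (l' / 2)) * (1 - s\<^sup>2) powr (- (l / 2))"
  shows "m = 0"
proof -
  define d where "d = real r + (l - l') / 2"
  have d: "d > 0" using l' by (simp add: d_def field_simps)
  have near: "eventually (\<lambda>s. s \<in> {0<..<1}) (at_left (1::real))"
    by (rule eventually_at_left_real) simp
  have ev: "eventually (\<lambda>s. cmod m * pochhammer l r * s ^ r \<le> C * (1 - s\<^sup>2) powr d) (at_left (1::real))"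
    using near
  proof eventually_elim
    fix s :: real assume s: "s \<in> {0<..<1}"
    have x: "1 - s\<^sup>2 > 0" using s by (simp add: abs_square_less_1)
    define y where "y = 1 - s\<^sup>2"
    have y: "y > 0" using x by (simp add: y_def)
    have "cmod m * pochhammer l r * s ^ r
        = (cmod m * cmod (atom_deriv r l (of_real s) (of_real s))) * y powr (l + real r)"
      using y by (simp add: norm_atom_deriv_of_real[OF l s] flip: y_def powr_add)
    also have "\<dots> \<le> (C * y powr (- (l' / 2)) * y powr (- (l / 2))) * y powr (l + real r)"
      unfolding y_def by (intro mult_right_mono bound s) simp
    also have "\<dots> = C * (y powr (- (l' / 2)) * y powr (- (l / 2)) * y powr (l + real r))"
      by simp
    also have "\<dots> = C * y powr d"
      unfolding powr_add[symmetric] by (simp add: d_def field_simps)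
    finally show "cmod m * pochhammer l r * s ^ r \<le> C * (1 - s\<^sup>2) powr d" by (simp only: y_def)
  qed
  have "((\<lambda>s. 1 - s\<^sup>2) \<longlongrightarrow> 1 - 1\<^sup>2) (at_left (1::real))"
    by (intro tendsto_intros)
  hence "((\<lambda>s. (1 - s\<^sup>2) powr d) \<longlongrightarrow> 0) (at_left (1::real))"
    using d eventually_mono[OF near, of "\<lambda>s. 0 \<le> 1 - s\<^sup>2"]
    by (intro tendsto_zero_powrI[where b = d]) (auto simp: abs_square_le_1)
  hence right: "((\<lambda>s. C * (1 - s\<^sup>2) powr d) \<longlongrightarrow> C * 0) (at_left (1::real))"
    by (intro tendsto_intros)
  have left: "((\<lambda>s. cmod m * pochhammer l r * s ^ r) \<longlongrightarrow> cmod m * pochhammer l r * 1 ^ r) (at_left (1::real))"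
    by (intro tendsto_intros)
  have "cmod m * pochhammer l r * 1 ^ r \<le> C * 0"
    by (rule tendsto_le[OF _ right left ev]) simp
  thus ?thesis using pochhammer_pos[OF l, of r] by (simp add: mult_le_0_iff)
qed

theorem lemma2p2:
  fixes n :: nat and lam :: "nat \<Rightarrow> real" and Lam :: real
    and m :: "nat \<Rightarrow> nat \<Rightarrow> complex"
    and H :: "nat \<Rightarrow> (complex \<Rightarrow> complex) set"
    and ip :: "nat \<Rightarrow> complex inner_product"
    and Tdiag :: "nat \<Rightarrow> (complex \<Rightarrow> complex) \<Rightarrow> complex \<Rightarrow> complex"
    and S :: "nat \<Rightarrow> nat \<Rightarrow> (complex \<Rightarrow> complex) \<Rightarrow> complex \<Rightarrow> complex"
    and T :: "(nat \<Rightarrow> complex \<Rightarrow> complex) \<Rightarrow> nat \<Rightarrow> complex \<Rightarrow> complex"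
    and D :: "(nat \<Rightarrow> complex \<Rightarrow> complex) set"
  assumes n: "n \<ge> 2"
    and lam0: "lam 0 > 0" and Lam_pos: "Lam > 0"
    and lam: "\<And>i. lam i = lam 0 + real i * Lam"
    and spaces: "\<And>i. i < n \<Longrightarrow> is_A_space (lam i) (H i) (ip i)"
    and Tdiag: "\<And>i. i < n \<Longrightarrow> Tdiag i = adjoint_op (H i) (ip i) mult_coord"
    and S_linear: "\<And>i j. i < j \<Longrightarrow> j < n \<Longrightarrow> linear_on_with fscale fscale (atom_span (lam j)) (S i j)"
    and S_atom: "\<And>i j w. i < j \<Longrightarrow> j < n \<Longrightarrow> w \<in> unit_disc \<Longrightarrow>
          S i j (atom (lam j) w) = fscale (m i j) (atom_deriv (j - i - 1) (lam i) w)"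
    and T: "T = upper_triangular_op n Tdiag S"
    and D: "D = direct_sum n (\<lambda>j. atom_span (lam j))"
    and Lam_less: "Lam < 2"
  shows
    "(Lam \<in> {1 + (real n - 3) / (real n - 1) ..< 2} \<longrightarrow> bounded_on_direct_sum n H ip D T) \<and>
     (\<forall>k. n \<ge> 4 \<and> k \<le> n - 3 \<and>
        Lam \<in> {1 + (real n - real k - 4) / (real n - real k - 2) ..<
               1 + (real n - real k - 3) / (real n - real k - 1)} \<longrightarrow>
        bounded_on_direct_sum n H ip D T \<longrightarrow> (\<forall>i j. i < j \<and> j < n \<and> j - i \<ge> n - k - 1 \<longrightarrow> m i j = 0)) \<and>
     (n \<ge> 3 \<and> Lam \<in> {0<..<1} \<longrightarrow>
        bounded_on_direct_sum n H ip D T \<longrightarrow> (\<forall>i j. i \<le> n - 2 \<and> j < n \<and> j > i + 1 \<longrightarrow> m i j = 0))"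
proof -
  have lam_pos: "lam i > 0" for i
    using lam0 Lam_pos lam[of i] by (simp add: add_pos_nonneg)
  have A: "A_space (lam i) (H i) (ip i)" if "i < n" for i
    using spaces[OF that] lam_pos by (intro A_space.intro)
  have inner: "function_inner_product (H i) (ip i)" if "i < n" for i
  proof -
    interpret A_space "lam i" "H i" "ip i" by (rule A[OF that])
    show ?thesis by unfold_locales
  qed
  have bounded: "bounded_on_direct_sum n H ip D T"
    if le: "\<And>i j. i < j \<Longrightarrow> j < n \<Longrightarrow> lam i + 2 * real (j - i - 1) \<le> lam j"
  proof -
    define R where "R i j = deriv_op (j - i - 1) (lam i) (lam j) (m i j)" for i j
    let ?A = "\<lambda>i j. if j < i then \<lambda>f. 0 else if j = i then backward_shift (lam i) else R i j"
    show ?thesis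
    proof (rule bounded_matrix_op[where A = ?A])
      show "function_inner_product (H i) (ip i)" if "i < n" for i
        by (rule inner[OF that])
      show "bounded_between (H j) (ip j) (H i) (ip i) (?A i j)" if "i < n" "j < n" for i j
      proof -
        interpret I: A_space "lam i" "H i" "ip i" by (rule A[OF that(1)])
        interpret J: A_space "lam j" "H j" "ip j" by (rule A[OF that(2)])
        consider "j < i" | "j = i" | "i < j" by linarith
        thus ?thesis
        proof cases
          case 1
          have "bounded_between (H j) (ip j) (H i) (ip i) (\<lambda>f. 0)"
            unfolding bounded_between_def linear_on_with_def
            by (intro conjI exI[of _ 0]) (auto simp: I.mem_0 I.ip_norm_0 fun_space.scale_zero_right)
          with 1 show ?thesis by simp
        next
          case 2
          thus ?thesis using I.backward.bounded_between_coeff_op by (simp add: backward_shift_def)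
        next
          case 3
          thus ?thesis
            using bounded_between_deriv_op[OF A[OF that(2)] A[OF that(1)] le[OF 3 that(2)]]
            by (simp add: R_def)
        qed
      qed
      fix F assume F: "F \<in> D"
      have F_span: "F i \<in> atom_span (lam i)" if "i < n" for i
        using F that by (simp add: D direct_sum_def)
      show "matrix_op n ?A F = T F"
      proof -
        have diag: "backward_shift (lam i) (F i) = Tdiag i (F i)" if "i < n" for i
        proof -
          interpret A_space "lam i" "H i" "ip i" by (rule A[OF that])
          show ?thesis using F_span[OF that] atom_span_subset
            by (simp add: Tdiag[OF that] adjoint_mult_coord subset_iff)
        qed
        have off: "R i j (F j) = S i j (F j)" if ij: "i < j" "j < n" for i j
        proof (rule eq_on_atom_span[OF _ S_linear[OF ij] _ F_span[OF ij(2)]])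
          interpret J: A_space "lam j" "H j" "ip j" by (rule A[OF ij(2)])
          have "i < n" using ij by simp
          from bounded_between_deriv_op[OF A[OF ij(2)] A[OF this] le[OF ij]]
          have "linear_on_with fscale fscale (H j) (R i j)"
            by (simp add: R_def bounded_between_def)
          thus "linear_on_with fscale fscale (atom_span (lam j)) (R i j)"
            using J.atom_span_subset unfolding linear_on_with_def by (meson subsetD)
          show "R i j (atom (lam j) w) = S i j (atom (lam j) w)" if "w \<in> unit_disc" for w
            unfolding R_def deriv_op_atom[OF lam_pos that] by (rule S_atom[OF ij that, symmetric])
        qed
        have "matrix_op n ?A F = upper_triangular_op n (\<lambda>i. backward_shift (lam i)) R F"
          by (simp only: upper_triangular_op_eq_matrix_op)
        also have "\<dots> = T F"
          unfolding T upper_triangular_op_def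
          by (intro ext[of "\<lambda>i. if i < n then _ i else _ i"]) (auto simp: diag off intro!: sum.cong)
        finally show ?thesis .
      qed
    qed
  qed
  have vanishing: "m i j = 0"
    if B: "bounded_on_direct_sum n H ip D T" and ij: "i < j" "j < n"
      and lt: "lam j < lam i + 2 * real (j - i - 1)" for i j
  proof -
    have i: "i < n" using ij by simp
    interpret I: A_space "lam i" "H i" "ip i" by (rule A[OF i])
    interpret J: A_space "lam j" "H j" "ip j" by (rule A[OF ij(2)])
    obtain B C where maps: "B ` direct_sum n H \<subseteq> direct_sum n H"
      and norm: "\<And>F. F \<in> direct_sum n H \<Longrightarrow> direct_sum_norm n ip (B F) \<le> C * direct_sum_norm n ip F"
      and agree: "\<And>F. F \<in> D \<Longrightarrow> B F = T F"
      using B unfolding bounded_on_direct_sum_def by blast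
    have span_0: "0 \<in> atom_span (lam k)" for k
      unfolding atom_span_def by (rule fun_space.span_zero)
    show ?thesis
    proof (rule zero_if_norm_bound[OF lam_pos lt, where C = C])
      fix s :: real assume s: "s \<in> {0<..<1}"
      let ?w = "complex_of_real s"
      have w: "?w \<in> unit_disc" using s by simp
      \<comment> \<open>A vector concentrated in the component \<open>j\<close> isolates the entry \<open>S i j\<close>.\<close>
      define F where "F k = (if k = j then atom (lam j) ?w else 0)" for k
      have "atom (lam j) ?w \<in> atom_span (lam j)"
        unfolding atom_span_def using w by (intro fun_space.span_base) auto
      hence F: "F \<in> D" using ij span_0 by (auto simp: D direct_sum_def F_def)
      have F_H: "F \<in> direct_sum n H"
        using F A_space.atom_span_subset[OF A] by (auto simp: D direct_sum_def)
      have S_0: "S i k 0 = 0" if "i < k" "k < n" for k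
        by (rule linear_on_with_0[OF S_linear[OF that] span_0])
      have T_0: "Tdiag i 0 = 0"
        unfolding Tdiag[OF i] I.adjoint_mult_coord[OF I.mem_0] backward_shift_def
        by (rule linear_on_with_0[OF I.backward.coeff_op_linear I.mem_0])
      have "T F i = Tdiag i (F i) + (\<Sum>k\<in>{i<..<n}. S i k (F k))"
        using i by (simp add: T upper_triangular_op_def)
      also have "\<dots> = (\<Sum>k\<in>{i<..<n}. if k = j then S i j (atom (lam j) ?w) else 0)"
      proof -
        have "Tdiag i (F i) = 0" using ij T_0 by (simp add: F_def)
        moreover have "(\<Sum>k\<in>{i<..<n}. S i k (F k))
            = (\<Sum>k\<in>{i<..<n}. if k = j then S i j (atom (lam j) ?w) else 0)"
          by (rule sum.cong[OF refl]) (simp add: F_def S_0)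
        ultimately show ?thesis by (simp only: add_0_left)
      qed
      also have "\<dots> = fscale (m i j) (atom_deriv (j - i - 1) (lam i) ?w)"
        using ij S_atom[OF ij w] by simp
      finally have TF: "T F i = fscale (m i j) (atom_deriv (j - i - 1) (lam i) ?w)" .
      have TF_H: "T F i \<in> H i"
        using maps F_H i unfolding agree[OF F, symmetric] by (auto simp: direct_sum_def)
      have norm_F: "direct_sum_norm n ip F = (1 - s\<^sup>2) powr (- (lam j / 2))"
      proof -
        have "(\<Sum>k<n. (ip_norm (ip k) (F k))\<^sup>2) = (\<Sum>k<n. if k = j then (ip_norm (ip j) (F j))\<^sup>2 else 0)"
          using function_inner_product.ip_norm_0[OF inner]
          by (intro sum.cong) (auto simp: F_def)
        also have "\<dots> = (ip_norm (ip j) (F j))\<^sup>2" using ij by simp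
        finally have "direct_sum_norm n ip F = ip_norm (ip j) (F j)"
          using F_H ij J.ip_norm_nonneg[of "F j"] by (simp add: direct_sum_norm_def direct_sum_def)
        also have "\<dots> = (1 - s\<^sup>2) powr (- (lam j / 2))"
          by (simp add: F_def J.ip_norm_atom_of_real[OF s])
        finally show ?thesis .
      qed
      have "cmod (m i j) * cmod (atom_deriv (j - i - 1) (lam i) ?w ?w) = cmod (T F i ?w)"
        by (simp add: TF fscale_def norm_mult)
      also have "\<dots> \<le> ip_norm (ip i) (T F i) * (1 - s\<^sup>2) powr (- (lam i / 2))"
        by (rule I.norm_le_ip_norm[OF TF_H s])
      also have "\<dots> \<le> (C * (1 - s\<^sup>2) powr (- (lam j / 2))) * (1 - s\<^sup>2) powr (- (lam i / 2))"
        using direct_sum_norm_component[OF i, of ip "T F"] norm[OF F_H]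
        by (intro mult_right_mono) (simp_all add: agree[OF F] norm_F)
      finally show "cmod (m i j) * cmod (atom_deriv (j - i - 1) (lam i) ?w ?w)
        \<le> C * (1 - s\<^sup>2) powr (- (lam j / 2)) * (1 - s\<^sup>2) powr (- (lam i / 2))" .
    qed
  qed
  \<comment> \<open>With \<open>d = j - i\<close> the entry \<open>(i, j)\<close> is admissible exactly when \<open>d * Lam \<ge> 2 * d - 2\<close>, that is
    \<open>Lam \<ge> 2 - 2 / d\<close>. This bound increases with \<open>d\<close>, and apart from \<open>2\<close> the endpoints of
    the intervals are its values at integers \<open>d\<close>.\<close>
  have gap: "lam j - lam i = real (j - i) * Lam" if "i < j" for i j
    using that by (simp add: lam[of i] lam[of j] of_nat_diff algebra_simps)
  have order: "real (j - i - 1) = real (j - i) - 1" if "i < j" for i j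
    using that by (simp add: of_nat_diff)
  show ?thesis
  proof (intro conjI impI allI)
    assume Lam: "Lam \<in> {1 + (real n - 3) / (real n - 1)..<2}"
    show "bounded_on_direct_sum n H ip D T"
    proof (rule bounded)
      fix i j assume ij: "i < j" "j < n"
      define d where "d = real (j - i)"
      have d: "d > 0" "d \<le> real n - 1" using ij by (auto simp: d_def of_nat_diff)
      have N: "real n - 1 > 0" using n by simp
      have "1 + (real n - 3) / (real n - 1) = 2 - 2 / (real n - 1)"
        using N by (simp add: field_simps)
      hence "d * (2 - 2 / (real n - 1)) \<le> d * Lam"
        using Lam d by (intro mult_left_mono) auto
      moreover have "d * (2 - 2 / (real n - 1)) = 2 * d - 2 * (d / (real n - 1))"
        by (simp add: right_diff_distrib)
      moreover have "d / (real n - 1) \<le> 1" using d N by simp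
      ultimately have "2 * d - 2 \<le> d * Lam" by simp
      thus "lam i + 2 * real (j - i - 1) \<le> lam j"
        using gap[OF ij(1)] order[OF ij(1)] by (simp add: d_def)
    qed
  next
    fix k i j
    assume k: "n \<ge> 4 \<and> k \<le> n - 3 \<and> Lam \<in> {1 + (real n - real k - 4) / (real n - real k - 2)..<
        1 + (real n - real k - 3) / (real n - real k - 1)}"
      and B: "bounded_on_direct_sum n H ip D T"
      and ij: "i < j \<and> j < n \<and> j - i \<ge> n - k - 1"
    define d where "d = real (j - i)"
    define N where "N = real n - real k - 1"
    have N: "N > 0" using k by (auto simp: N_def)
    have "k + 1 \<le> n" using k by linarith
    hence "real (n - (k + 1)) = real n - real (k + 1)" by (rule of_nat_diff)
    hence "real (n - k - 1) = N" by (simp add: N_def)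
    hence d: "d \<ge> N" using ij unfolding d_def by (metis of_nat_le_iff)
    have "1 + (real n - real k - 3) / (real n - real k - 1) = 2 - 2 / N"
      using N by (simp add: N_def field_simps)
    hence "Lam < 2 - 2 / N" using k by simp
    hence "d * Lam < d * (2 - 2 / N)"
      using d N by (intro mult_strict_left_mono) auto
    moreover have "d * (2 - 2 / N) = 2 * d - 2 * (d / N)" by (simp add: right_diff_distrib)
    moreover have "d / N \<ge> 1" using d N by simp
    ultimately have "d * Lam < 2 * d - 2" by simp
    thus "m i j = 0"
      using ij gap[of i j] order[of i j] by (intro vanishing[OF B]) (auto simp: d_def)
  next
    fix i j
    assume 3: "n \<ge> 3 \<and> Lam \<in> {0<..<1}" and B: "bounded_on_direct_sum n H ip D T"
      and ij: "i \<le> n - 2 \<and> j < n \<and> j > i + 1"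
    define d where "d = real (j - i)"
    have d: "d \<ge> 2" using ij by (simp add: d_def)
    hence "d * Lam < d * 1" using 3 by (intro mult_strict_left_mono) auto
    hence "d * Lam < 2 * d - 2" using d by linarith
    thus "m i j = 0"
      using ij gap[of i j] order[of i j] by (intro vanishing[OF B]) (auto simp: d_def)
  qed
qed

end
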